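(* Let $G$ be a finite group of order $n>1$, let $p$ be the largest prime divisor of $n$, and let $P$ be a Sylow $p$-subgroup of $G$. If either $P$ is not normal in $G$ or $P$ is nonabelian, then $S_c(G)\leq S_c(C_n)$, where $C_n$ is the cyclic group of order $n$.
   Context: All groups are finite. $\mathrm{Irr}(G)$ denotes the set of complex irreducible characters of a finite group $G$. For $\chi\in\mathrm{Irr}(G)$, the codegree of $\chi$ is $\mathrm{cod}(\chi)=\frac{|G:\ker\chi|}{\chi(1)}$. The sum of codegrees is $S_c(G)=\sum_{\chi\in\mathrm{Irr}(G)}\mathrm{cod}(\chi)$. *)

theory Defs
  imports
    "HOL-Algebra.Elementary_Groups"
    "HOL-Computational_Algebra.Primes"
    "Jordan_Normal_Form.VS_Connect"
begin

(* units_of (ring_mat TYPE(complex) d ()) is GL_d(C). *)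
definition representation ::
  "('a, 'm) monoid_scheme \<Rightarrow> nat \<Rightarrow> ('a \<Rightarrow> complex mat) \<Rightarrow> bool"
  where "representation G d \<rho> \<longleftrightarrow> \<rho> \<in> hom G (units_of (ring_mat TYPE(complex) d ()))"

definition irreducible_representation ::
  "('a, 'm) monoid_scheme \<Rightarrow> nat \<Rightarrow> ('a \<Rightarrow> complex mat) \<Rightarrow> bool"
  where "irreducible_representation G d \<rho> \<longleftrightarrow>
    representation G d \<rho> \<and> d \<noteq> 0 \<and>
    (\<forall>W. VectorSpace.subspace class_ring W (module_vec TYPE(complex) d) \<and>
         (\<forall>g \<in> carrier G. \<forall>v \<in> W. \<rho> g *\<^sub>v v \<in> W) \<longrightarrow>
         W = {0\<^sub>v d} \<or> W = carrier_vec d)"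

definition trace_mat :: "'a::comm_monoid_add mat \<Rightarrow> 'a"
  where "trace_mat A = (\<Sum>i<dim_row A. A $$ (i, i))"

(* Characters are cut off outside the carrier (restrict), so that two characters of G are equal
   as HOL functions iff they agree on G, and Irr G counts each of them exactly once. *)
definition character ::
  "('a, 'm) monoid_scheme \<Rightarrow> ('a \<Rightarrow> complex mat) \<Rightarrow> 'a \<Rightarrow> complex"
  where "character G \<rho> = (\<lambda>g\<in>carrier G. trace_mat (\<rho> g))"

definition Irr :: "('a, 'm) monoid_scheme \<Rightarrow> ('a \<Rightarrow> complex) set"
  where "Irr G = {character G \<rho> | d \<rho>. irreducible_representation G d \<rho>}"

definition char_kernel :: "('a, 'm) monoid_scheme \<Rightarrow> ('a \<Rightarrow> complex) \<Rightarrow> 'a set"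
  where "char_kernel G \<chi> = {g \<in> carrier G. \<chi> g = \<chi> \<one>\<^bsub>G\<^esub>}"

(* chi(1) is a positive integer embedded in the complex numbers (Irr_at_one below), so Re only
   changes its type. *)
definition codegree :: "('a, 'm) monoid_scheme \<Rightarrow> ('a \<Rightarrow> complex) \<Rightarrow> real"
  where "codegree G \<chi> = real (card (rcosets\<^bsub>G\<^esub> (char_kernel G \<chi>))) / Re (\<chi> \<one>\<^bsub>G\<^esub>)"

definition sum_codegrees :: "('a, 'm) monoid_scheme \<Rightarrow> real"
  where "sum_codegrees G = (\<Sum>\<chi>\<in>Irr G. codegree G \<chi>)"

definition sylow_subgroup :: "nat \<Rightarrow> 'a set \<Rightarrow> ('a, 'm) monoid_scheme \<Rightarrow> bool"
  where "sylow_subgroup p P G \<longleftrightarrow>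
    prime p \<and> subgroup P G \<and> card P = p ^ multiplicity p (Coset.order G)"

lemma Irr_at_one:
  assumes "group G" and "\<chi> \<in> Irr G"
  shows "\<exists>d>0. \<chi> \<one>\<^bsub>G\<^esub> = of_nat d"
proof -
  obtain d \<rho> where \<chi>: "\<chi> = character G \<rho>" and irr: "irreducible_representation G d \<rho>"
    using assms(2) unfolding Irr_def by blast
  let ?R = "ring_mat TYPE(complex) d ()"
  interpret R: ring ?R by (rule ring_mat)
  have "\<rho> \<in> hom G (units_of ?R)" and d: "d > 0"
    using irr unfolding irreducible_representation_def representation_def by auto
  then have "\<rho> \<one>\<^bsub>G\<^esub> = \<one>\<^bsub>units_of ?R\<^esub>"
    using hom_one[OF _ assms(1) R.units_group] by blast
  then have "\<rho> \<one>\<^bsub>G\<^esub> = 1\<^sub>m d"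
    by (simp add: units_of_def ring_mat_def)
  then have "\<chi> \<one>\<^bsub>G\<^esub> = of_nat d"
    using group.is_monoid[OF assms(1)]
    by (simp add: \<chi> character_def trace_mat_def monoid.one_closed)
  with d show ?thesis by blast
qed

end

theory Submission
  imports Defs "HOL-Algebra.Group_Action" "HOL-Algebra.Multiplicative_Group"
    "HOL-Library.Function_Algebras" "HOL-Number_Theory.Totient"
    "Jordan_Normal_Form.Spectral_Radius"
begin

text \<open>
  Both sides are compared with \<open>2 n\<^sup>2 / (p + 1)\<close>.

  Every codegree is at most \<open>n\<close>, and by Schur orthogonality the irreducible characters are linearly
  independent class functions, so \<open>S\<^sub>c(G) \<le> n k(G)\<close>, where \<open>k(G)\<close> is the number of conjugacy classes
  (\<open>card_Irr_le_card_conj_classes\<close>, \<open>sum_codegrees_le\<close>).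

  To bound \<open>k(G)\<close>, let \<open>Z\<close> be the centralizer of the normal closure of \<open>P\<close>. An element outside \<open>Z\<close> has a
  conjugate that \<open>P\<close> moves under conjugation, and orbits of a \<open>p\<close>-group have \<open>p\<close>-power size; so classes
  outside \<open>Z\<close> have at least \<open>p\<close> elements and \<open>k(G) \<le> |Z| + (n - |Z|) / p\<close>. If the index of \<open>Z\<close> were at
  most \<open>p\<close>, then either \<open>P \<subseteq> Z\<close>, or \<open>G / Z\<close> has order \<open>p\<close> and is generated by the image of an element
  of \<open>P\<close>. In both cases \<open>P\<close> is normal and abelian, which is excluded. Hence \<open>(p + 1) |Z| \<le> n\<close>, and
  therefore \<open>(p + 1) k(G) \<le> 2 n\<close> (\<open>card_conj_classes_le\<close>).

  On the cyclic side, the \<open>n\<close> linear characters of \<open>C\<^sub>n\<close> have codegrees \<open>n / gcd(j, n)\<close>, whose sum is the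
  multiplicative function \<open>\<Sum>d | n. d \<phi>(d)\<close>. A prime power \<open>q\<^sup>k\<close> contributes at least
  \<open>q\<^sup>2\<^sup>k q / (q + 1)\<close>, and the product of \<open>q / (q + 1)\<close> over any set of primes up to \<open>p\<close> is no smaller
  than the telescoping product of \<open>i / (i + 1)\<close> over \<open>2 \<le> i \<le> p\<close>, which is \<open>2 / (p + 1)\<close>
  (\<open>divisor_totient_sum_lower_bound\<close>).
\<close>

section \<open>The sum of d times phi(d) over the divisors d of n\<close>

text \<open>
  This is also the sum of the element orders of the cyclic group of order \<open>n\<close>.
\<close>

definition divisor_totient_sum :: "nat \<Rightarrow> nat"
  where "divisor_totient_sum n = (\<Sum>d | d dvd n. d * totient d)"

text \<open>
  The divisors of \<open>q\<^sup>k m\<close> are the products of a divisor of \<open>q\<^sup>k\<close> and a divisor of \<open>m\<close>, in a unique way,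
  and \<open>\<phi>\<close> is multiplicative on coprime factors.
\<close>

lemma divisor_totient_sum_prime_power_mult:
  assumes q: "prime q" and m: "m > 0" "coprime q m"
  shows "divisor_totient_sum (q ^ k * m) = divisor_totient_sum (q ^ k) * divisor_totient_sum m"
proof -
  have cop: "coprime a b" if "a dvd q ^ k" "b dvd m" for a b
    using that m(2) by (meson coprime_divisors coprime_power_left_iff)
  have "bij_betw (\<lambda>(a, b). a * b) ({a. a dvd q ^ k} \<times> {b. b dvd m}) {d. d dvd q ^ k * m}"
    unfolding bij_betw_def
  proof
    show "inj_on (\<lambda>(a, b). a * b) ({a. a dvd q ^ k} \<times> {b. b dvd m})"
    proof (rule inj_onI, clarsimp)
      fix a b a' b' assume h: "a dvd q ^ k" "b dvd m" "a' dvd q ^ k" "b' dvd m" "a * b = a' * b'"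
      have "a = a'"
      proof (rule dvd_antisym)
        show "a dvd a'" using h cop[of a b'] by (metis coprime_dvd_mult_left_iff dvd_triv_left)
        show "a' dvd a" using h cop[of a' b] by (metis coprime_dvd_mult_left_iff dvd_triv_left)
      qed
      moreover have "a > 0" using h(1) q by (auto intro!: Nat.gr0I simp: prime_gt_0_nat)
      ultimately show "a = a' \<and> b = b'" using h(5) by simp
    qed
    show "(\<lambda>(a, b). a * b) ` ({a. a dvd q ^ k} \<times> {b. b dvd m}) = {d. d dvd q ^ k * m}"
    proof (intro equalityI subsetI)
      fix d assume "d \<in> {d. d dvd q ^ k * m}"
      then obtain a b where "d = a * b" "a dvd q ^ k" "b dvd m"
        using division_decomp[of d "q ^ k" m] by blast
      then show "d \<in> (\<lambda>(a, b). a * b) ` ({a. a dvd q ^ k} \<times> {b. b dvd m})"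
        by (intro image_eqI[of _ _ "(a, b)"]) auto
    qed (auto intro: mult_dvd_mono)
  qed
  then have "divisor_totient_sum (q ^ k * m)
      = (\<Sum>(a, b)\<in>{a. a dvd q ^ k} \<times> {b. b dvd m}. (a * b) * totient (a * b))"
    unfolding divisor_totient_sum_def by (subst sum.reindex_bij_betw[symmetric], assumption) (simp add: case_prod_beta)
  also have "\<dots> = (\<Sum>(a, b)\<in>{a. a dvd q ^ k} \<times> {b. b dvd m}. (a * totient a) * (b * totient b))"
    by (rule sum.cong) (auto simp: totient_mult_coprime cop)
  also have "\<dots> = divisor_totient_sum (q ^ k) * divisor_totient_sum m"
    unfolding divisor_totient_sum_def by (simp add: sum_product sum.cartesian_product)
  finally show ?thesis .
qed

lemma divisor_totient_sum_prime_power: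
  assumes "prime q"
  shows "(q + 1) * divisor_totient_sum (q ^ k) = q ^ (2 * k + 1) + 1"
proof (induction k)
  case 0
  then show ?case by (simp add: divisor_totient_sum_def)
next
  case (Suc k)
  have *: "{d. d dvd q ^ Suc k} = insert (q ^ Suc k) {d. d dvd q ^ k}"
    unfolding divides_primepow_nat[OF assms] by (auto simp: le_Suc_eq simp del: power_Suc)
  have "\<not> q ^ Suc k dvd q ^ k"
    using assms by (metis Suc_n_not_le_n dvd_power_iff_le prime_ge_2_nat)
  moreover have "finite {d. d dvd q ^ k}" using assms prime_gt_0_nat by (intro finite_divisors_nat) simp
  ultimately have "divisor_totient_sum (q ^ Suc k)
      = q ^ Suc k * totient (q ^ Suc k) + divisor_totient_sum (q ^ k)"
    unfolding divisor_totient_sum_def * by (subst sum.insert) auto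
  also have "totient (q ^ Suc k) = q ^ k * (q - 1)"
    by (rule totient_prime_power_Suc[OF assms])
  finally have **: "(q + 1) * divisor_totient_sum (q ^ Suc k)
      = (q + 1) * (q ^ Suc k * (q ^ k * (q - 1))) + (q ^ (2 * k + 1) + 1)"
    using Suc.IH by (simp add: distrib_left)
  obtain r where "q = Suc r" using assms by (metis not0_implies_Suc not_prime_0)
  then show ?case unfolding ** by (simp add: algebra_simps power_add power_mult power2_eq_square mult_2)
qed

text \<open>
  Induction on \<open>t\<close> makes the telescoping product explicit: raising the bound from \<open>t\<close> to \<open>t + 1\<close> costs
  the factor \<open>(t + 1) / (t + 2)\<close>, and this is what the power of \<open>t + 1\<close> in \<open>n\<close> loses when \<open>t + 1\<close> is prime.
  For composite \<open>t + 1\<close> the bound only gets weaker.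
\<close>

lemma divisor_totient_sum_lower_bound:
  assumes "n > 0" and "\<And>q. prime q \<Longrightarrow> q dvd n \<Longrightarrow> q \<le> t" and "t > 0"
  shows "2 * n ^ 2 \<le> (t + 1) * divisor_totient_sum n"
  using assms(3,1,2)
proof (induction t arbitrary: n rule: nat_induct_non_zero)
  case 1
  have "n = 1"
    using 1 by (metis One_nat_def Suc_n_not_le_n le_trans prime_factor_nat prime_ge_2_nat Suc_1)
  then show ?case by (simp add: divisor_totient_sum_def)
next
  case (Suc t)
  show ?case
  proof (cases "prime (Suc t)")
    case False
    have "q \<le> t" if "prime q" "q dvd n" for q
      using Suc.prems(2)[OF that] that(1) False by (metis le_SucE)
    then have "2 * n ^ 2 \<le> (t + 1) * divisor_totient_sum n"
      using Suc.IH[of n] Suc.prems(1) by blast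
    then show ?thesis by simp
  next
    case True
    define q where "q = Suc t"
    have q: "prime q" using True q_def by simp
    obtain k m where n: "n = q ^ k * m" and "\<not> q dvd m"
      using Suc.prems(1) q
      by (metis multiplicity_decompose' not_gr_zero not_prime_unit)
    then have cop: "coprime q m" and m: "m > 0"
      using q Suc.prems(1) prime_imp_coprime by (blast, auto)
    have "r \<le> t" if "prime r" "r dvd m" for r
    proof -
      have "r \<le> Suc t" using Suc.prems(2)[of r] that n by simp
      moreover have "r \<noteq> Suc t" using that \<open>\<not> q dvd m\<close> q_def by blast
      ultimately show ?thesis by simp
    qed
    then have IH: "2 * m ^ 2 \<le> q * divisor_totient_sum m"
      using Suc.IH[OF m] q_def by simp
    have "2 * n ^ 2 = q ^ (2 * k) * (2 * m ^ 2)"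
      by (simp add: n power_mult_distrib power_mult[symmetric] mult.commute)
    also have "\<dots> \<le> q ^ (2 * k) * (q * divisor_totient_sum m)"
      using IH by (rule mult_le_mono2)
    also have "\<dots> = q ^ (2 * k + 1) * divisor_totient_sum m" by simp
    also have "\<dots> \<le> ((q + 1) * divisor_totient_sum (q ^ k)) * divisor_totient_sum m"
      unfolding divisor_totient_sum_prime_power[OF q] by (rule mult_le_mono1) simp
    also have "\<dots> = (Suc t + 1) * divisor_totient_sum n"
      by (simp only: n divisor_totient_sum_prime_power_mult[OF q m cop] q_def[symmetric] mult.assoc)
    finally show ?thesis .
  qed
qed

lemma sum_gcd_quotient_eq_divisor_totient_sum:
  assumes "n > 0"
  shows "(\<Sum>j<n. n div gcd j n) = divisor_totient_sum n"
proof -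
  \<comment> \<open>The residue \<open>0\<close> is traded for \<open>n\<close>, which has the same gcd with \<open>n\<close>.\<close>
  have "(\<Sum>j<n. n div gcd j n) = (\<Sum>j\<in>{0<..n}. n div gcd j n)"
    by (rule sum.reindex_bij_witness[where i = "\<lambda>j. j mod n" and j = "\<lambda>j. if j = 0 then n else j"])
      (use assms in \<open>auto simp: le_less gcd.commute\<close>)
  also have "\<dots> = (\<Sum>d\<in>{d. d dvd n}. \<Sum>j\<in>{j\<in>{0<..n}. n div gcd j n = d}. n div gcd j n)"
    by (rule sum.group[symmetric]) (use assms in \<open>auto intro: div_dvd_iff_mult[THEN iffD2]\<close>)
  also have "\<dots> = (\<Sum>d | d dvd n. d * totient d)"
  proof (rule sum.cong[OF refl])
    fix d assume "d \<in> {d. d dvd n}"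
    then have d: "d dvd n" by simp
    have "{j\<in>{0<..n}. n div gcd j n = d} = {j\<in>{0<..n}. gcd j n = n div d}"
      using assms d by (auto simp: dvd_div_eq_mult elim!: dvdE) 
    moreover have "n div d dvd n" using d by (metis dvd_div_mult_self dvd_triv_left)
    ultimately have "card {j\<in>{0<..n}. n div gcd j n = d} = totient (n div (n div d))"
      using card_gcd_eq_totient[of n "n div d"] assms by (simp only:)
    then show "(\<Sum>j\<in>{j\<in>{0<..n}. n div gcd j n = d}. n div gcd j n) = d * totient d"
      using assms d by auto
  qed
  finally show ?thesis unfolding divisor_totient_sum_def .
qed

section \<open>The number of conjugacy classes\<close>

definition conj_class :: "('a, 'm) monoid_scheme \<Rightarrow> 'a \<Rightarrow> 'a set"
  where "conj_class G x = {g \<otimes>\<^bsub>G\<^esub> x \<otimes>\<^bsub>G\<^esub> inv\<^bsub>G\<^esub> g | g. g \<in> carrier G}"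

definition conj_classes :: "('a, 'm) monoid_scheme \<Rightarrow> 'a set set"
  where "conj_classes G = conj_class G ` carrier G"

text \<open>
  For a subgroup \<open>P\<close> this is the centralizer of the normal closure of \<open>P\<close>. Asking that all conjugates of
  \<open>x\<close> centralize \<open>P\<close>, instead of \<open>x\<close> centralizing all conjugates of \<open>P\<close>, makes its complement exactly the
  union of those classes on which \<open>P\<close> acts nontrivially.
\<close>

definition conj_centralizer :: "('a, 'm) monoid_scheme \<Rightarrow> 'a set \<Rightarrow> 'a set"
  where "conj_centralizer G P =
    {x \<in> carrier G. \<forall>y \<in> conj_class G x. \<forall>u \<in> P. y \<otimes>\<^bsub>G\<^esub> u = u \<otimes>\<^bsub>G\<^esub> y}"

context group
begin

lemma conj_class_subset: "x \<in> carrier G \<Longrightarrow> conj_class G x \<subseteq> carrier G"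
  by (auto simp: conj_class_def)

lemma conj_class_refl: "x \<in> carrier G \<Longrightarrow> x \<in> conj_class G x"
  unfolding conj_class_def by (auto intro!: exI[of _ "\<one>"])

lemma conj_classI: "g \<in> carrier G \<Longrightarrow> g \<otimes> x \<otimes> inv g \<in> conj_class G x"
  unfolding conj_class_def by auto

lemma conj_class_mono:
  assumes "x \<in> carrier G" "y \<in> conj_class G x"
  shows "conj_class G y \<subseteq> conj_class G x"
proof
  fix z assume "z \<in> conj_class G y"
  then obtain g h where gh: "g \<in> carrier G" "h \<in> carrier G" "y = g \<otimes> x \<otimes> inv g" "z = h \<otimes> y \<otimes> inv h"
    using assms(2) unfolding conj_class_def by auto
  then have "z = (h \<otimes> g) \<otimes> x \<otimes> inv (h \<otimes> g)"
    using assms(1) by (simp add: m_assoc inv_mult_group)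
  then show "z \<in> conj_class G x" using gh conj_classI by simp
qed

lemma conj_class_sym:
  assumes "x \<in> carrier G" "y \<in> conj_class G x"
  shows "x \<in> conj_class G y"
proof -
  obtain g where g: "g \<in> carrier G" "y = g \<otimes> x \<otimes> inv g"
    using assms(2) unfolding conj_class_def by auto
  then have "x = inv g \<otimes> y \<otimes> inv (inv g)"
    using assms(1) by (simp add: m_assoc[symmetric]) (simp add: m_assoc)
  then show ?thesis using g conj_classI[of "inv g" y] by simp
qed

lemma conj_class_eq:
  assumes "x \<in> carrier G" "y \<in> conj_class G x"
  shows "conj_class G y = conj_class G x"
proof (rule subset_antisym)
  show "conj_class G y \<subseteq> conj_class G x" using assms by (rule conj_class_mono)
  show "conj_class G x \<subseteq> conj_class G y"
    using conj_class_mono[of y x] conj_class_sym[OF assms] conj_class_subset[OF assms(1)] assms(2) by blast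
qed

lemma disjoint_conj_classes:
  assumes "C \<in> conj_classes G" "D \<in> conj_classes G" "C \<noteq> D"
  shows "C \<inter> D = {}"
  using assms conj_class_eq unfolding conj_classes_def by blast

text \<open>
  The class is not fixed pointwise by \<open>P\<close>, and the size of a nontrivial orbit of the \<open>p\<close>-group \<open>P\<close> is a
  multiple of \<open>p\<close>.
\<close>

lemma card_conj_class_ge_prime:
  assumes fin: "finite (carrier G)" and p: "prime p"
    and P: "subgroup P G" "card P = p ^ a"
    and x: "x \<in> carrier G" "x \<notin> conj_centralizer G P"
  shows "p \<le> card (conj_class G x)"
proof -
  obtain y u where y: "y \<in> conj_class G x" and u: "u \<in> P" "y \<otimes> u \<noteq> u \<otimes> y"
    using x unfolding conj_centralizer_def by auto
  have yG: "y \<in> carrier G" and uG: "u \<in> carrier G"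
    using y conj_class_subset[OF x(1)] u subgroup.subset[OF P(1)] by auto
  define \<phi> where "\<phi> = (\<lambda>g. \<lambda>h \<in> carrier G. g \<otimes> h \<otimes> inv g)"
  let ?H = "G\<lparr>carrier := P\<rparr>"
  interpret A: group_action ?H "carrier G" \<phi>
    unfolding \<phi>_def by (rule group_action.induced_action[OF action_by_conjugation P(1)])
  let ?O = "orbit ?H \<phi> y"
  have O: "?O = {g \<otimes> y \<otimes> inv g | g. g \<in> P}"
    using yG by (auto simp: orbit_def \<phi>_def)
  have sub: "?O \<subseteq> conj_class G y"
    unfolding O conj_class_def using subgroup.subset[OF P(1)] by auto
  have finO: "finite ?O"
    using sub conj_class_subset[OF yG] fin by (meson finite_subset)
  have "card ?O * card (stabilizer ?H \<phi> y) = p ^ a"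
    using A.orbit_stabilizer_theorem[OF yG] P(2) by (simp add: Coset.order_def)
  then have "card ?O dvd p ^ a" by (metis dvd_triv_left)
  then obtain i where i: "card ?O = p ^ i"
    using p by (auto simp: divides_primepow_nat)
  have "y \<in> ?O"
    unfolding O using yG subgroup.one_closed[OF P(1)] by (auto intro!: exI[of _ "\<one>"])
  moreover have "u \<otimes> y \<otimes> inv u \<in> ?O" unfolding O using u by auto
  moreover have "u \<otimes> y \<otimes> inv u \<noteq> y"
  proof
    assume "u \<otimes> y \<otimes> inv u = y"
    then have "y \<otimes> u = u \<otimes> y \<otimes> inv u \<otimes> u" by simp
    then show False using u(2) yG uG by (simp add: m_assoc)
  qed
  ultimately have "card ?O \<noteq> 1" by (auto simp: card_1_singleton_iff)
  then have "i \<noteq> 0" using i by auto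
  then have "p \<le> card ?O"
    using i self_le_power[of p i] prime_ge_1_nat[OF p] by simp
  also have "\<dots> \<le> card (conj_class G y)"
    using sub conj_class_subset[OF yG] fin by (meson card_mono finite_subset)
  also have "conj_class G y = conj_class G x" using conj_class_eq[OF x(1) y] .
  finally show ?thesis .
qed

lemma conj_centralizer_conj:
  assumes "x \<in> conj_centralizer G P" "y \<in> conj_class G x"
  shows "y \<in> conj_centralizer G P"
  using assms conj_class_mono[of x y] conj_class_subset[of x] unfolding conj_centralizer_def by blast

lemma conj_centralizer_iff:
  "x \<in> conj_centralizer G P \<longleftrightarrow> x \<in> carrier G \<and>
    (\<forall>g \<in> carrier G. \<forall>u \<in> P. (g \<otimes> x \<otimes> inv g) \<otimes> u = u \<otimes> (g \<otimes> x \<otimes> inv g))"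
  unfolding conj_centralizer_def conj_class_def by blast

lemma commute_mult:
  assumes "x \<in> carrier G" "y \<in> carrier G" "u \<in> carrier G" "x \<otimes> u = u \<otimes> x" "y \<otimes> u = u \<otimes> y"
  shows "(x \<otimes> y) \<otimes> u = u \<otimes> (x \<otimes> y)"
proof -
  have "(x \<otimes> y) \<otimes> u = x \<otimes> (u \<otimes> y)" using assms by (simp add: m_assoc)
  also have "\<dots> = (u \<otimes> x) \<otimes> y" using assms(1-4) by (simp add: m_assoc[symmetric])
  finally show ?thesis using assms(1-3) by (simp add: m_assoc)
qed

lemma commute_inv:
  assumes "x \<in> carrier G" "u \<in> carrier G" "x \<otimes> u = u \<otimes> x"
  shows "inv x \<otimes> u = u \<otimes> inv x"
proof -
  have "inv x \<otimes> (u \<otimes> x) \<otimes> inv x = inv x \<otimes> (x \<otimes> u) \<otimes> inv x" using assms(3) by simp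
  moreover have "inv x \<otimes> (x \<otimes> u) \<otimes> inv x = u \<otimes> inv x"
    using assms(1,2) by (simp add: m_assoc[symmetric])
  moreover have "inv x \<otimes> (u \<otimes> x) \<otimes> inv x = inv x \<otimes> u"
    using assms(1,2) by (simp add: m_assoc)
  ultimately show ?thesis by simp
qed

lemma conj_mult:
  assumes "x \<in> carrier G" "y \<in> carrier G" "g \<in> carrier G"
  shows "g \<otimes> (x \<otimes> y) \<otimes> inv g = (g \<otimes> x \<otimes> inv g) \<otimes> (g \<otimes> y \<otimes> inv g)"
proof -
  have "inv g \<otimes> (g \<otimes> (y \<otimes> inv g)) = y \<otimes> inv g"
    using assms by (simp add: m_assoc[symmetric])
  then show ?thesis using assms by (simp add: m_assoc)
qed

lemma conj_inv:
  assumes "x \<in> carrier G" "g \<in> carrier G"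
  shows "g \<otimes> inv x \<otimes> inv g = inv (g \<otimes> x \<otimes> inv g)"
  using assms by (simp add: inv_mult_group m_assoc)

lemma conj_centralizer_normal:
  assumes "P \<subseteq> carrier G"
  shows "conj_centralizer G P \<lhd> G"
proof -
  have PG: "u \<in> carrier G" if "u \<in> P" for u using assms that by auto
  have "subgroup (conj_centralizer G P) G"
  proof
    show "\<one> \<in> conj_centralizer G P"
      using PG by (auto simp: conj_centralizer_iff)
    fix x y assume x: "x \<in> conj_centralizer G P" 
    show "inv x \<in> conj_centralizer G P"
      using x PG by (auto simp: conj_centralizer_iff conj_inv intro!: commute_inv)
    assume y: "y \<in> conj_centralizer G P"
    show "x \<otimes> y \<in> conj_centralizer G P"
      unfolding conj_centralizer_iff
    proof (intro conjI ballI)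
      fix g u assume gu: "g \<in> carrier G" "u \<in> P"
      have "(g \<otimes> x \<otimes> inv g) \<otimes> (g \<otimes> y \<otimes> inv g) \<otimes> u = u \<otimes> ((g \<otimes> x \<otimes> inv g) \<otimes> (g \<otimes> y \<otimes> inv g))"
        by (rule commute_mult) (use x y gu PG in \<open>auto simp: conj_centralizer_iff\<close>)
      then show "g \<otimes> (x \<otimes> y) \<otimes> inv g \<otimes> u = u \<otimes> (g \<otimes> (x \<otimes> y) \<otimes> inv g)"
        using x y gu by (simp add: conj_mult conj_centralizer_iff)
    qed (use x y in \<open>auto simp: conj_centralizer_iff\<close>)
  qed (auto simp: conj_centralizer_def)
  then show ?thesis
    unfolding normal_inv_iff using conj_centralizer_conj conj_classI by blast
qed

text \<open>
  The classes inside \<open>Z = conj_centralizer G P\<close> number at most \<open>|Z|\<close>; those outside are disjoint subsets of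
  \<open>G - Z\<close> of size at least \<open>p\<close>. The inequality is written without subtraction or division.
\<close>

lemma card_conj_classes_bound:
  assumes fin: "finite (carrier G)" and p: "prime p"
    and P: "subgroup P G" "card P = p ^ a"
  shows "p * card (conj_classes G) + card (conj_centralizer G P)
    \<le> Coset.order G + p * card (conj_centralizer G P)"
proof -
  let ?Z = "conj_centralizer G P"
  let ?D = "conj_class G ` (carrier G - ?Z)"
  have ZG: "?Z \<subseteq> carrier G" by (auto simp: conj_centralizer_def)
  have "conj_classes G = conj_class G ` ?Z \<union> ?D" unfolding conj_classes_def using ZG by blast
  then have "card (conj_classes G) \<le> card (conj_class G ` ?Z) + card ?D"
    by (simp add: card_Un_le)
  also have "card (conj_class G ` ?Z) \<le> card ?Z"
    using ZG fin by (meson card_image_le finite_subset)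
  finally have 1: "card (conj_classes G) \<le> card ?Z + card ?D" by simp
  have "card ?D * p \<le> (\<Sum>C\<in>?D. card C)"
    using card_conj_class_ge_prime[OF fin p P] by (intro sum_bounded_below[where K = p, simplified]) auto
  also have "\<dots> = card (\<Union>?D)"
  proof (rule card_Union_disjoint[symmetric])
    show "pairwise disjnt ?D"
      using disjoint_conj_classes unfolding pairwise_def disjnt_def conj_classes_def by blast
    show "finite C" if "C \<in> ?D" for C
      using that fin conj_class_subset by (auto intro: finite_subset)
  qed
  also have "\<dots> \<le> card (carrier G - ?Z)"
  proof (rule card_mono)
    show "\<Union>?D \<subseteq> carrier G - ?Z"
    proof (clarsimp, intro conjI)
      fix x y assume x: "x \<in> carrier G" "x \<notin> ?Z" and y: "y \<in> conj_class G x"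
      show "y \<in> carrier G" using x y conj_class_subset by blast
      show "y \<notin> ?Z" using x y conj_class_sym conj_centralizer_conj by blast
    qed
  qed (use fin in simp)
  also have "\<dots> = Coset.order G - card ?Z"
    using fin ZG by (simp add: card_Diff_subset finite_subset Coset.order_def)
  finally have 2: "card ?D * p \<le> Coset.order G - card ?Z" .
  have "card ?Z \<le> Coset.order G" using fin ZG by (simp add: card_mono Coset.order_def)
  then have "p * card ?D + card ?Z \<le> Coset.order G" using 2 by (simp add: mult.commute)
  moreover have "p * card (conj_classes G) \<le> p * card ?Z + p * card ?D"
    using 1 by (metis distrib_left mult_le_mono2)
  ultimately show ?thesis by simp
qed

text \<open>
  In the quotient by \<open>P\<close> the order of the image of \<open>y\<close> divides both \<open>|P|\<close> and the index of \<open>P\<close>.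
\<close>

lemma normal_sylow_contains:
  assumes N: "P \<lhd> G" and fin: "finite (carrier G)" and cop: "coprime (card P) (card (rcosets P))"
    and y: "y \<in> carrier G" "y [^] (card P) = \<one>"
  shows "y \<in> P"
proof -
  interpret N: normal P G by fact
  interpret Q: group "G Mod P" by (rule N.factorgroup_is_group)
  have yQ: "P #> y \<in> carrier (G Mod P)" using y by (simp add: carrier_FactGroup)
  have "(P #> y) [^]\<^bsub>G Mod P\<^esub> card P = \<one>\<^bsub>G Mod P\<^esub>"
    using y by (simp add: N.FactGroup_pow N.is_subgroup coset_join2)
  then have "Q.ord (P #> y) dvd card P" using Q.pow_eq_id[OF yQ] by simp
  moreover have "Q.ord (P #> y) dvd card (rcosets P)"
    using Q.ord_dvd_group_order[OF yQ] by (simp add: Coset.order_def FactGroup_def)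
  ultimately have "Q.ord (P #> y) = 1" using cop by (metis coprime_common_divisor_nat)
  then have "P #> y = P" using Q.ord_eq_1[OF yQ] by simp
  then show ?thesis using rcos_self[OF y(1) N.is_subgroup] by simp
qed

lemma pow_conj:
  assumes "x \<in> carrier G" "g \<in> carrier G"
  shows "(g \<otimes> x \<otimes> inv g) [^] (k::nat) = g \<otimes> x [^] k \<otimes> inv g"
  using assms by (induction k) (simp_all add: conj_mult[symmetric])

text \<open>
  Such a \<open>P\<close> is central in \<open>Z = conj_centralizer G P\<close>, hence normal there, so by the index assumption it
  contains all elements of \<open>Z\<close> whose order divides \<open>|P|\<close>. As \<open>Z\<close> is normal in \<open>G\<close>, these include all
  \<open>G\<close>-conjugates of elements of \<open>P\<close>.
\<close>

lemma normal_abelian_if_conj_centralizer_contains: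
  assumes fin: "finite (carrier G)" and P: "subgroup P G" "P \<subseteq> conj_centralizer G P"
    and cop: "coprime (card P) (card (rcosets P))"
  shows "P \<lhd> G \<and> comm_group (G\<lparr>carrier := P\<rparr>)"
proof -
  let ?Z = "conj_centralizer G P"
  note PG = subgroup.subset[OF P(1)]
  have Z: "?Z \<lhd> G" using conj_centralizer_normal[OF PG] .
  then have subZ: "subgroup ?Z G" by (rule normal_imp_subgroup)
  have comm: "z \<otimes> u = u \<otimes> z" if "z \<in> ?Z" "u \<in> P" for z u
    using that conj_class_refl[of z] unfolding conj_centralizer_def by blast
  let ?H = "G\<lparr>carrier := ?Z\<rparr>"
  interpret H: group ?H by (rule subgroup_imp_group[OF subZ])
  have PH: "subgroup P ?H" using subgroup_incl[OF P(1) subZ P(2)] .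
  have invH: "inv\<^bsub>?H\<^esub> x = inv x" if "x \<in> ?Z" for x using m_inv_consistent[OF subZ that] .
  have ZG: "?Z \<subseteq> carrier G" by (auto simp: conj_centralizer_def)
  have "P \<lhd> ?H"
    unfolding H.normal_inv_iff
  proof (intro conjI ballI)
    fix x h assume x: "x \<in> carrier ?H" and h: "h \<in> P"
    then have xh: "x \<in> ?Z" "x \<in> carrier G" "h \<in> carrier G" "x \<otimes> h = h \<otimes> x"
      using comm[of x h] PG ZG by auto
    then have "x \<otimes> h \<otimes> inv x = h" by (simp add: m_assoc)
    then show "x \<otimes>\<^bsub>?H\<^esub> h \<otimes>\<^bsub>?H\<^esub> inv\<^bsub>?H\<^esub> x \<in> P"
      unfolding invH[OF xh(1)] using h by simp
  qed (rule PH)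
  moreover have "coprime (card P) (card (rcosets\<^bsub>?H\<^esub> P))"
  proof -
    have "card (rcosets\<^bsub>?H\<^esub> P) * card P = card ?Z"
      using H.lagrange[OF PH] by (simp add: Coset.order_def)
    moreover have "card (rcosets ?Z) * card ?Z = card (rcosets P) * card P"
      using lagrange[OF subZ] lagrange[OF P(1)] by simp
    ultimately have "card (rcosets P) * card P = (card (rcosets ?Z) * card (rcosets\<^bsub>?H\<^esub> P)) * card P"
      by (simp only: mult.assoc)
    moreover have "card P \<noteq> 0"
      using subgroup.one_closed[OF P(1)] finite_subset[OF PG fin] by auto
    ultimately have "card (rcosets P) = card (rcosets ?Z) * card (rcosets\<^bsub>?H\<^esub> P)"
      by (simp only: mult_cancel2)  blast
    then show ?thesis using cop by (simp only: coprime_mult_right_iff)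
  qed
  ultimately have PZ: "P \<lhd> ?H" "coprime (card P) (card (rcosets\<^bsub>?H\<^esub> P))" .
  have inP: "y \<in> P" if "y \<in> ?Z" "y [^] card P = \<one>" for y
  proof (rule H.normal_sylow_contains[OF PZ(1) _ PZ(2)])
    show "finite (carrier ?H)" using finite_subset[OF ZG fin] by simp
    show "y \<in> carrier ?H" using that(1) by simp
    show "y [^]\<^bsub>?H\<^esub> card P = \<one>\<^bsub>?H\<^esub>" using that(2) by (simp flip: nat_pow_consistent)
  qed
  have "P \<lhd> G"
    unfolding normal_inv_iff
  proof (intro conjI ballI)
    fix x h assume x: "x \<in> carrier G" and h: "h \<in> P"
    interpret PP: group "G\<lparr>carrier := P\<rparr>" by (rule subgroup_imp_group[OF P(1)])
    have "h [^] card P = \<one>"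
      using PP.pow_order_eq_1[of h] h by (simp add: Coset.order_def nat_pow_consistent[symmetric])
    moreover have hG: "h \<in> carrier G" using h PG by blast
    ultimately have "(x \<otimes> h \<otimes> inv x) [^] card P = \<one>"
      using x pow_conj[OF hG x, of "card P"] by simp
    moreover have "x \<otimes> h \<otimes> inv x \<in> ?Z"
      using P(2) h by (intro normal.inv_op_closed2[OF Z x]) blast
    ultimately show "x \<otimes> h \<otimes> inv x \<in> P" by (intro inP)
  qed (rule P(1))
  moreover have "comm_group (G\<lparr>carrier := P\<rparr>)"
    using P(2) comm by (intro group.group_comm_groupI[OF subgroup_imp_group[OF P(1)]]) auto
  ultimately show ?thesis ..
qed

text \<open>
  Some \<open>x \<in> P\<close> has nontrivial image in \<open>G / Z\<close>. The order of this image is a power of \<open>p\<close>, and the group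
  has at most \<open>p\<close> elements, so it is generated by the image of \<open>x\<close>. Thus every element of \<open>G\<close> is \<open>z x\<^sup>i\<close>
  with \<open>z\<close> centralizing \<open>P\<close>, and such elements normalize \<open>P\<close>; those in \<open>P\<close> commute with each other.
\<close>

lemma normal_abelian_if_prime_index_conj_centralizer:
  assumes fin: "finite (carrier G)" and p: "prime p"
    and P: "subgroup P G" "card P = p ^ a" "\<not> P \<subseteq> conj_centralizer G P"
    and idx: "card (rcosets (conj_centralizer G P)) \<le> p"
  shows "P \<lhd> G \<and> comm_group (G\<lparr>carrier := P\<rparr>)"
proof -
  let ?Z = "conj_centralizer G P"
  note PG = subgroup.subset[OF P(1)]
  have Z: "?Z \<lhd> G" using conj_centralizer_normal[OF PG] .
  then have subZ: "subgroup ?Z G" by (rule normal_imp_subgroup)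
  have ZG: "?Z \<subseteq> carrier G" by (auto simp: conj_centralizer_def)
  have comm: "z \<otimes> u = u \<otimes> z" if "z \<in> ?Z" "u \<in> P" for z u
    using that conj_class_refl[of z] unfolding conj_centralizer_def by blast
  interpret Z: normal ?Z G by (rule Z)
  interpret Q: group "G Mod ?Z" by (rule Z.factorgroup_is_group)
  interpret PP: group "G\<lparr>carrier := P\<rparr>" by (rule subgroup_imp_group[OF P(1)])
  obtain x where x: "x \<in> P" "x \<notin> ?Z" using P(3) by blast
  have xG: "x \<in> carrier G" using x PG by blast
  have powP: "x [^] (i::nat) \<in> P" for i
    using PP.nat_pow_closed[of x i] x by (simp add: nat_pow_consistent[symmetric])
  let ?X = "?Z #> x"
  have XQ: "?X \<in> carrier (G Mod ?Z)" using xG by (simp add: carrier_FactGroup)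
  have finQ: "finite (carrier (G Mod ?Z))" using fin by (simp add: carrier_FactGroup)
  have ordQ: "Coset.order (G Mod ?Z) \<le> p" using idx by (simp add: Coset.order_def FactGroup_def)
  have "x [^] card P = \<one>"
    using PP.pow_order_eq_1[of x] x by (simp add: Coset.order_def nat_pow_consistent[symmetric])
  then have "?X [^]\<^bsub>G Mod ?Z\<^esub> card P = \<one>\<^bsub>G Mod ?Z\<^esub>"
    using xG by (simp add: Z.FactGroup_pow subZ coset_join2)
  then have "Q.ord ?X dvd p ^ a" using Q.pow_eq_id[OF XQ] P(2) by simp
  then obtain i where i: "Q.ord ?X = p ^ i" using p by (auto simp: divides_primepow_nat)
  have "?X \<noteq> \<one>\<^bsub>G Mod ?Z\<^esub>" using x xG rcos_self[OF xG subZ] by auto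
  then have "i \<noteq> 0" using i Q.ord_eq_1[OF XQ] by auto
  then have "p \<le> Q.ord ?X"
    using i self_le_power[of p i] prime_ge_1_nat[OF p] by simp
  then have "card (generate (G Mod ?Z) {?X}) \<ge> card (carrier (G Mod ?Z))"
    using ordQ Q.generate_pow_card[OF XQ] by (simp add: Coset.order_def)
  then have gen: "generate (G Mod ?Z) {?X} = carrier (G Mod ?Z)"
    using finQ Q.generate_incl[of "{?X}"] XQ by (intro card_seteq) auto
  have decomp: "\<exists>z \<in> ?Z. \<exists>i::nat. g = z \<otimes> x [^] i" if g: "g \<in> carrier G" for g
  proof -
    have "?Z #> g \<in> generate (G Mod ?Z) {?X}" unfolding gen using g by (simp add: carrier_FactGroup)
    then obtain k::nat where "?Z #> g = ?X [^]\<^bsub>G Mod ?Z\<^esub> k"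
      using Q.generate_pow_on_finite_carrier[OF finQ XQ] by auto
    then have "?Z #> g = ?Z #> (x [^] k)" using xG by (simp add: Z.FactGroup_pow)
    then have "g \<in> ?Z #> (x [^] k)" using rcos_self[OF g subZ] by simp
    then show ?thesis unfolding r_coset_def by auto
  qed
  have conjx: "g \<otimes> h \<otimes> inv g \<in> P \<and> (g \<in> P \<longrightarrow> h \<in> P \<longrightarrow> g \<otimes> h = h \<otimes> g)"
    if g: "g \<in> carrier G" and h: "h \<in> P" for g h
  proof -
    obtain z i where z: "z \<in> ?Z" "g = z \<otimes> x [^] (i::nat)" using decomp[OF g] by blast
    have hG: "h \<in> carrier G" and zG: "z \<in> carrier G" using h z PG ZG by auto
    define w where "w = x [^] i \<otimes> h \<otimes> inv (x [^] i)"
    have w: "w \<in> P" "w \<in> carrier G"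
    proof -
      show "w \<in> P"
        unfolding w_def by (intro subgroup.m_closed[OF P(1)] subgroup.m_inv_closed[OF P(1)] powP h)
      then show "w \<in> carrier G" using PG by blast
    qed
    have "g \<otimes> h \<otimes> inv g = z \<otimes> w \<otimes> inv z"
      using z hG zG xG by (simp add: w_def m_assoc inv_mult_group)
    also have "\<dots> = w" using comm[OF z(1) w(1)] w zG by (simp add: m_assoc)
    finally have 1: "g \<otimes> h \<otimes> inv g = w" .
    obtain z' j where z': "z' \<in> ?Z" "h = z' \<otimes> x [^] (j::nat)" using decomp[OF hG] by blast
    have z'G: "z' \<in> carrier G" using z' ZG by auto
    have "x [^] i \<otimes> h = h \<otimes> x [^] i"
    proof -
      have "x [^] i \<otimes> h = z' \<otimes> (x [^] i \<otimes> x [^] j)"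
        using comm[OF z'(1) powP[of i]] z' z'G xG by (simp add: m_assoc[symmetric])
      also have "x [^] i \<otimes> x [^] j = x [^] j \<otimes> x [^] i"
        using xG by (simp add: nat_pow_mult add.commute)
      finally show ?thesis using z' z'G xG by (simp add: m_assoc)
    qed
    then have 2: "g \<otimes> h = h \<otimes> g"
      using commute_mult[OF zG _ hG comm[OF z(1) h], of "x [^] i"] z(2) xG by simp
    show ?thesis using 1 w 2 by simp
  qed
  have "P \<lhd> G" unfolding normal_inv_iff using P(1) conjx by blast
  moreover have "comm_group (G\<lparr>carrier := P\<rparr>)"
    using conjx PG by (intro group.group_comm_groupI[OF subgroup_imp_group[OF P(1)]]) auto
  ultimately show ?thesis ..
qed

end

text \<open>
  The two preceding lemmas give \<open>(p + 1) |Z| \<le> n\<close>. Inserting this into \<open>p k \<le> n + (p - 1) |Z|\<close> yields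
  \<open>p (p + 1) k \<le> (p + 1) n + (p - 1) n = 2 p n\<close>.
\<close>

lemma card_conj_classes_le:
  assumes G: "group G" and fin: "finite (carrier G)"
    and syl: "sylow_subgroup p P G"
    and bad: "\<not> P \<lhd> G \<or> \<not> comm_group (G\<lparr>carrier := P\<rparr>)"
  shows "(p + 1) * card (conj_classes G) \<le> 2 * Coset.order G"
proof -
  interpret group G by fact
  let ?Z = "conj_centralizer G P" and ?n = "Coset.order G"
  have p: "prime p" and P: "subgroup P G" "card P = p ^ multiplicity p ?n"
    using syl unfolding sylow_subgroup_def by auto
  have n: "?n > 0" using fin by (simp add: order_gt_0_iff_finite)
  have "coprime p (card (rcosets\<^bsub>G\<^esub> P))"
  proof -
    have "?n = card (rcosets\<^bsub>G\<^esub> P) * p ^ multiplicity p ?n" using lagrange[OF P(1)] P(2) by simp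
    then have "p ^ Suc (multiplicity p ?n) dvd ?n" if "p dvd card (rcosets\<^bsub>G\<^esub> P)"
      using that by (metis mult_dvd_mono dvd_refl power_Suc)
    moreover have "\<not> p ^ Suc (multiplicity p ?n) dvd ?n"
      using n p by (subst power_dvd_iff_le_multiplicity) auto
    ultimately have "\<not> p dvd card (rcosets\<^bsub>G\<^esub> P)" by blast
    then show ?thesis using p prime_imp_coprime by blast
  qed
  then have "coprime (card P) (card (rcosets\<^bsub>G\<^esub> P))" using P(2) by simp
  then have "\<not> card (rcosets\<^bsub>G\<^esub> ?Z) \<le> p"
    using bad normal_abelian_if_conj_centralizer_contains[OF fin P(1)]
      normal_abelian_if_prime_index_conj_centralizer[OF fin p P] by blast
  then have "(p + 1) * card ?Z \<le> card (rcosets\<^bsub>G\<^esub> ?Z) * card ?Z" by (intro mult_le_mono1) simp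
  also have "\<dots> = ?n"
    by (rule lagrange) (rule normal_imp_subgroup[OF conj_centralizer_normal[OF subgroup.subset[OF P(1)]]])
  finally have Z: "(p + 1) * card ?Z \<le> ?n" .
  have "p * card (conj_classes G) + card ?Z \<le> ?n + p * card ?Z"
    by (rule card_conj_classes_bound[OF fin p P])
  then have "(p + 1) * (p * card (conj_classes G) + card ?Z) \<le> (p + 1) * (?n + p * card ?Z)"
    by (rule mult_le_mono2)
  then have "p * ((p + 1) * card (conj_classes G)) + (p + 1) * card ?Z
      \<le> (p + 1) * ?n + p * ((p + 1) * card ?Z)"
    by (simp add: algebra_simps)
  moreover obtain r where r: "p = Suc r" using p by (metis not0_implies_Suc not_prime_0)
  moreover have "r * ((p + 1) * card ?Z) \<le> r * ?n" using Z by (rule mult_le_mono2)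
  ultimately have "p * ((p + 1) * card (conj_classes G)) \<le> (p + 1) * ?n + r * ?n" by (simp add: algebra_simps)
  also have "\<dots> = p * (2 * ?n)" using r by (simp add: algebra_simps)
  finally show ?thesis using p by (simp add: prime_gt_0_nat)
qed

section \<open>Schur's lemma\<close>

lemma trace_mat_mult:
  "trace_mat (A * B) = (\<Sum>i<dim_row A. \<Sum>j<dim_row B. A $$ (i, j) * B $$ (j, i))"
  if "A \<in> carrier_mat n m" "B \<in> carrier_mat m n" for A B :: "complex mat"
  using that unfolding trace_mat_def by (auto simp: scalar_prod_def atLeast0LessThan)

lemma trace_mat_commute:
  fixes A B :: "complex mat"
  assumes "A \<in> carrier_mat n m" "B \<in> carrier_mat m n"
  shows "trace_mat (A * B) = trace_mat (B * A)"
  using assms by (simp add: trace_mat_mult[OF assms] trace_mat_mult[OF assms(2,1)])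
    (subst sum.swap, simp add: mult.commute)

lemma mult_mat_index_sum:
  fixes A B :: "complex mat"
  assumes "A \<in> carrier_mat n m" "B \<in> carrier_mat m l" "i < n" "j < l"
  shows "(A * B) $$ (i, j) = (\<Sum>k<m. A $$ (i, k) * B $$ (k, j))"
  using assms by (auto simp: scalar_prod_def atLeast0LessThan)

lemma subspace_vecI:
  fixes W :: "complex vec set"
  assumes "W \<subseteq> carrier_vec d" "0\<^sub>v d \<in> W" "\<And>v w. v \<in> W \<Longrightarrow> w \<in> W \<Longrightarrow> v + w \<in> W"
    "\<And>c v. v \<in> W \<Longrightarrow> c \<cdot>\<^sub>v v \<in> W"
  shows "VectorSpace.subspace class_ring W (module_vec TYPE(complex) d)"
proof -
  interpret vec_space "TYPE(complex)" d .
  have "submodule class_ring W V"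
    unfolding submodule_def using assms module_axioms by (auto simp: module_vec_simps class_ring_simps)
  then show ?thesis unfolding VectorSpace.subspace_def using vectorspace_axioms by blast
qed

lemma
  assumes "representation G d \<rho>"
  shows representation_carrier: "g \<in> carrier G \<Longrightarrow> \<rho> g \<in> carrier_mat d d"
    and representation_mult: "g \<in> carrier G \<Longrightarrow> h \<in> carrier G \<Longrightarrow> \<rho> (g \<otimes>\<^bsub>G\<^esub> h) = \<rho> g * \<rho> h"
  using assms unfolding representation_def hom_def
  by (auto simp: units_of_def Units_def ring_mat_simps Pi_iff)

lemma representation_one:
  assumes "group G" "representation G d \<rho>"
  shows "\<rho> \<one>\<^bsub>G\<^esub> = 1\<^sub>m d"
proof -
  let ?R = "ring_mat TYPE(complex) d ()"
  interpret R: ring ?R by (rule ring_mat)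
  have "\<rho> \<one>\<^bsub>G\<^esub> = \<one>\<^bsub>units_of ?R\<^esub>"
    using hom_one[OF _ assms(1) R.units_group] assms(2) unfolding representation_def by blast
  then show ?thesis by (simp add: units_of_def ring_mat_def)
qed

definition intertwines :: "('a, 'm) monoid_scheme \<Rightarrow> complex mat \<Rightarrow> ('a \<Rightarrow> complex mat) \<Rightarrow> ('a \<Rightarrow> complex mat) \<Rightarrow> bool"
  where "intertwines G T \<rho> \<sigma> \<longleftrightarrow> (\<forall>g \<in> carrier G. \<rho> g * T = T * \<sigma> g)"

text \<open>
  The kernel of an intertwiner is an invariant subspace, and it is proper because the intertwiner is nonzero.
\<close>

lemma intertwiner_kernel_trivial:
  assumes \<sigma>: "irreducible_representation G e \<sigma>" and \<rho>: "representation G d \<rho>"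
    and T: "T \<in> carrier_mat d e" "T \<noteq> 0\<^sub>m d e" "intertwines G T \<rho> \<sigma>"
    and v: "v \<in> carrier_vec e" "T *\<^sub>v v = 0\<^sub>v d"
  shows "v = 0\<^sub>v e"
proof -
  let ?W = "{v \<in> carrier_vec e. T *\<^sub>v v = 0\<^sub>v d}"
  have rep: "representation G e \<sigma>" using \<sigma> unfolding irreducible_representation_def by blast
  have "VectorSpace.subspace class_ring ?W (module_vec TYPE(complex) e)"
    using T(1) by (intro subspace_vecI) (auto simp: mult_add_distrib_mat_vec mult_mat_vec)
  moreover have "\<sigma> g *\<^sub>v w \<in> ?W" if g: "g \<in> carrier G" and w: "w \<in> ?W" for g w
  proof -
    have c: "\<sigma> g \<in> carrier_mat e e" "\<rho> g \<in> carrier_mat d d"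
      using representation_carrier[OF rep g] representation_carrier[OF \<rho> g] .
    have "T *\<^sub>v (\<sigma> g *\<^sub>v w) = (T * \<sigma> g) *\<^sub>v w" using c T(1) w by (simp add: assoc_mult_mat_vec)
    also have "T * \<sigma> g = \<rho> g * T" using T(3) g unfolding intertwines_def by simp
    also have "(\<rho> g * T) *\<^sub>v w = \<rho> g *\<^sub>v (T *\<^sub>v w)" using c T(1) w by (simp add: assoc_mult_mat_vec)
    finally show ?thesis using w c by (auto intro!: mult_mat_vec_carrier)
  qed
  ultimately have "?W = {0\<^sub>v e} \<or> ?W = carrier_vec e"
    using \<sigma> unfolding irreducible_representation_def by blast
  moreover have "?W \<noteq> carrier_vec e"
  proof
    assume all: "?W = carrier_vec e"
    have "T = 0\<^sub>m d e"
    proof (rule eq_matI)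
      fix i j assume ij: "i < dim_row (0\<^sub>m d e)" "j < dim_col (0\<^sub>m d e)"
      have "T *\<^sub>v unit_vec e j = 0\<^sub>v d" using all unit_vec_carrier[of e j] by blast
      then have "(T *\<^sub>v unit_vec e j) $ i = 0" using ij by simp
      then show "T $$ (i, j) = 0\<^sub>m d e $$ (i, j)" using ij T(1) by (auto simp: scalar_prod_right_unit)
    qed (use T(1) in auto)
    then show False using T(2) by simp
  qed
  ultimately show ?thesis using v by blast
qed

text \<open>
  Dually, the image is an invariant subspace that is not zero.
\<close>

lemma intertwiner_surjective:
  assumes \<rho>: "irreducible_representation G d \<rho>" and \<sigma>: "representation G e \<sigma>"
    and T: "T \<in> carrier_mat d e" "T \<noteq> 0\<^sub>m d e" "intertwines G T \<rho> \<sigma>"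
    and v: "v \<in> carrier_vec d"
  shows "\<exists>w \<in> carrier_vec e. T *\<^sub>v w = v"
proof -
  let ?W = "(\<lambda>w. T *\<^sub>v w) ` carrier_vec e"
  have rep: "representation G d \<rho>" using \<rho> unfolding irreducible_representation_def by blast
  have "VectorSpace.subspace class_ring ?W (module_vec TYPE(complex) d)"
  proof (rule subspace_vecI)
    show "0\<^sub>v d \<in> ?W" using T(1) by (intro image_eqI[of _ _ "0\<^sub>v e"]) auto
    show "v + w \<in> ?W" if vw: "v \<in> ?W" "w \<in> ?W" for v w
    proof -
      obtain a b where "a \<in> carrier_vec e" "b \<in> carrier_vec e" "v = T *\<^sub>v a" "w = T *\<^sub>v b"
        using vw by blast
      then show ?thesis
        using T(1) by (intro image_eqI[of _ _ "a + b"]) (simp_all add: mult_add_distrib_mat_vec)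
    qed
    show "c \<cdot>\<^sub>v v \<in> ?W" if vw: "v \<in> ?W" for c v
    proof -
      obtain a where "a \<in> carrier_vec e" "v = T *\<^sub>v a" using vw by blast
      then show ?thesis
        using T(1) by (intro image_eqI[of _ _ "c \<cdot>\<^sub>v a"]) (simp_all add: mult_mat_vec)
    qed
  qed (use T(1) in \<open>auto intro: mult_mat_vec_carrier\<close>)
  moreover have "\<rho> g *\<^sub>v w \<in> ?W" if g: "g \<in> carrier G" and "w \<in> ?W" for g w
  proof -
    obtain u where u: "u \<in> carrier_vec e" "w = T *\<^sub>v u" using \<open>w \<in> ?W\<close> by blast
    have c: "\<sigma> g \<in> carrier_mat e e" "\<rho> g \<in> carrier_mat d d"
      using representation_carrier[OF \<sigma> g] representation_carrier[OF rep g] .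
    have "\<rho> g *\<^sub>v w = (\<rho> g * T) *\<^sub>v u" using c T(1) u by (simp add: assoc_mult_mat_vec)
    also have "\<rho> g * T = T * \<sigma> g" using T(3) g unfolding intertwines_def by simp
    also have "(T * \<sigma> g) *\<^sub>v u = T *\<^sub>v (\<sigma> g *\<^sub>v u)" using c T(1) u by (simp add: assoc_mult_mat_vec)
    finally show ?thesis using u c by (auto intro: mult_mat_vec_carrier)
  qed
  ultimately have "?W = {0\<^sub>v d} \<or> ?W = carrier_vec d"
    using \<rho> unfolding irreducible_representation_def by blast
  moreover have "?W \<noteq> {0\<^sub>v d}"
  proof
    assume all: "?W = {0\<^sub>v d}"
    have "T = 0\<^sub>m d e"
    proof (rule eq_matI)
      fix i j assume ij: "i < dim_row (0\<^sub>m d e)" "j < dim_col (0\<^sub>m d e)"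
      have "T *\<^sub>v unit_vec e j = 0\<^sub>v d" using all unit_vec_carrier[of e j] by blast
      then have "(T *\<^sub>v unit_vec e j) $ i = 0" using ij by simp
      then show "T $$ (i, j) = 0\<^sub>m d e $$ (i, j)" using ij T(1) by (auto simp: scalar_prod_right_unit)
    qed (use T(1) in auto)
    then show False using T(2) by simp
  qed
  ultimately have "v \<in> ?W" using v by blast
  then show ?thesis by blast
qed

text \<open>
  Surjectivity gives a right inverse \<open>S\<close> of \<open>T\<close> column by column, and injectivity makes it a left inverse,
  so \<open>tr \<rho>(g) = tr (\<rho>(g) T S) = tr (T \<sigma>(g) S) = tr (\<sigma>(g) S T) = tr \<sigma>(g)\<close>.
  Cyclicity of the trace applies to rectangular \<open>T\<close>.
\<close>

lemma trace_eq_if_intertwiner: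
  assumes \<rho>: "irreducible_representation G d \<rho>" and \<sigma>: "irreducible_representation G e \<sigma>"
    and T: "T \<in> carrier_mat d e" "T \<noteq> 0\<^sub>m d e" "intertwines G T \<rho> \<sigma>"
    and g: "g \<in> carrier G"
  shows "trace_mat (\<rho> g) = trace_mat (\<sigma> g)"
proof -
  have rep: "representation G d \<rho>" "representation G e \<sigma>"
    using \<rho> \<sigma> unfolding irreducible_representation_def by blast+
  have c: "\<rho> g \<in> carrier_mat d d" "\<sigma> g \<in> carrier_mat e e"
    using representation_carrier[OF rep(1) g] representation_carrier[OF rep(2) g] .
  have "\<exists>w. w \<in> carrier_vec e \<and> T *\<^sub>v w = unit_vec d j" for j
    using intertwiner_surjective[OF \<rho> rep(2) T, of "unit_vec d j"] by auto
  then obtain s where s: "s j \<in> carrier_vec e" "T *\<^sub>v s j = unit_vec d j" for j by metis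
  define S where "S = mat e d (\<lambda>(i, j). s j $ i)"
  have S: "S \<in> carrier_mat e d" unfolding S_def by simp
  have colS: "col S j = s j" if "j < d" for j
    using that s(1)[of j] unfolding S_def by (intro eq_vecI) auto
  have TS: "T * S = 1\<^sub>m d"
  proof (rule eq_matI)
    fix i j assume ij: "i < dim_row (1\<^sub>m d)" "j < dim_col (1\<^sub>m d)"
    have "(T * S) $$ (i, j) = (T *\<^sub>v s j) $ i" using ij T(1) S colS by simp
    then show "(T * S) $$ (i, j) = 1\<^sub>m d $$ (i, j)" using ij s(2) by auto
  qed (use T(1) S in auto)
  have ST: "S * T = 1\<^sub>m e"
  proof (rule eq_matI)
    fix i j assume ij: "i < dim_row (1\<^sub>m e)" "j < dim_col (1\<^sub>m e)"
    let ?u = "unit_vec e j :: complex vec"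
    have z: "(S * T) *\<^sub>v ?u - ?u \<in> carrier_vec e" using S T(1) by auto
    have "T *\<^sub>v ((S * T) *\<^sub>v ?u - ?u) = T *\<^sub>v ((S * T) *\<^sub>v ?u) - T *\<^sub>v ?u"
      using S T(1) by (intro mult_minus_distrib_mat_vec) auto
    also have "T *\<^sub>v ((S * T) *\<^sub>v ?u) = (T * S * T) *\<^sub>v ?u"
    proof -
      have "T *\<^sub>v ((S * T) *\<^sub>v ?u) = (T * (S * T)) *\<^sub>v ?u"
        using S T(1) by (intro assoc_mult_mat_vec[symmetric]) auto
      also have "T * (S * T) = T * S * T" using S T(1) by (intro assoc_mult_mat[symmetric])
      finally show ?thesis .
    qed
    also have "T * S * T = T" using TS T(1) by simp
    finally have "T *\<^sub>v ((S * T) *\<^sub>v ?u - ?u) = 0\<^sub>v d" using T(1) by auto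
    then have "(S * T) *\<^sub>v ?u - ?u = 0\<^sub>v e"
      by (rule intertwiner_kernel_trivial[OF \<sigma> rep(1) T z])
    then have "((S * T) *\<^sub>v ?u - ?u) $ i = 0" using ij by simp
    moreover have "T *\<^sub>v ?u = col T j"
      using ij T(1) by (intro eq_vecI) (auto simp: scalar_prod_right_unit)
    ultimately show "(S * T) $$ (i, j) = 1\<^sub>m e $$ (i, j)"
      using ij S T(1) by auto
  qed (use T(1) S in auto)
  have "trace_mat (\<rho> g) = trace_mat (\<rho> g * (T * S))" using TS c by simp
  also have "\<rho> g * (T * S) = (\<rho> g * T) * S" using c T(1) S by (simp add: assoc_mult_mat)
  also have "\<rho> g * T = T * \<sigma> g" using T(3) g unfolding intertwines_def by simp
  also have "trace_mat (T * \<sigma> g * S) = trace_mat (S * (T * \<sigma> g))"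
    using c T(1) S by (intro trace_mat_commute[of _ d e]) auto
  also have "S * (T * \<sigma> g) = (S * T) * \<sigma> g" using c T(1) S by (simp add: assoc_mult_mat)
  also have "\<dots> = \<sigma> g" using ST c by simp
  finally show ?thesis .
qed

text \<open>
  If \<open>c\<close> is an eigenvalue of \<open>T\<close>, then \<open>T - c 1\<close> is an intertwiner with nontrivial kernel, hence zero.
\<close>

lemma intertwiner_scalar:
  assumes \<rho>: "irreducible_representation G d \<rho>"
    and T: "T \<in> carrier_mat d d" "intertwines G T \<rho> \<rho>"
  shows "\<exists>c. T = c \<cdot>\<^sub>m 1\<^sub>m d"
proof -
  have d: "d > 0" and rep: "representation G d \<rho>" using \<rho> unfolding irreducible_representation_def by auto
  obtain c where "eigenvalue T c" using spectrum_non_empty[OF T(1) d] unfolding spectrum_def by blast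
  then obtain v where v: "v \<in> carrier_vec d" "v \<noteq> 0\<^sub>v d" "T *\<^sub>v v = c \<cdot>\<^sub>v v"
    using T(1) unfolding eigenvalue_def eigenvector_def by auto
  let ?T = "T - c \<cdot>\<^sub>m 1\<^sub>m d"
  have T': "?T \<in> carrier_mat d d" using T(1) by auto
  have "?T *\<^sub>v v = T *\<^sub>v v - (c \<cdot>\<^sub>m 1\<^sub>m d) *\<^sub>v v"
    using T(1) v(1) by (intro minus_mult_distrib_mat_vec) auto
  also have "(c \<cdot>\<^sub>m 1\<^sub>m d) *\<^sub>v v = c \<cdot>\<^sub>v v"
    using v(1) by (intro eq_vecI) auto
  also have "T *\<^sub>v v - c \<cdot>\<^sub>v v = 0\<^sub>v d" using v by simp
  finally have 0: "?T *\<^sub>v v = 0\<^sub>v d" .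
  have "intertwines G ?T \<rho> \<rho>"
    unfolding intertwines_def
  proof
    fix g assume g: "g \<in> carrier G"
    have c: "\<rho> g \<in> carrier_mat d d" by (rule representation_carrier[OF rep g])
    have "\<rho> g * ?T = \<rho> g * T - \<rho> g * (c \<cdot>\<^sub>m 1\<^sub>m d)" using c T(1) by (intro mult_minus_distrib_mat) auto
    also have "\<dots> = T * \<rho> g - (c \<cdot>\<^sub>m 1\<^sub>m d) * \<rho> g"
    proof -
      have "\<rho> g * (c \<cdot>\<^sub>m 1\<^sub>m d) = (c \<cdot>\<^sub>m 1\<^sub>m d) * \<rho> g"
        using c by (simp add: mult_smult_distrib[OF c one_carrier_mat] mult_smult_assoc_mat[of _ d d])
      then show ?thesis using T(2) g unfolding intertwines_def by simp
    qed
    also have "\<dots> = ?T * \<rho> g" using c T(1) by (intro minus_mult_distrib_mat[symmetric]) auto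
    finally show "\<rho> g * ?T = ?T * \<rho> g" .
  qed
  then have "?T = 0\<^sub>m d d" using intertwiner_kernel_trivial[OF \<rho> rep T' _ _ v(1) 0] v(2) by blast
  have "T = c \<cdot>\<^sub>m 1\<^sub>m d"
  proof (rule eq_matI)
    fix i j assume ij: "i < dim_row (c \<cdot>\<^sub>m 1\<^sub>m d)" "j < dim_col (c \<cdot>\<^sub>m 1\<^sub>m d)"
    then have "?T $$ (i, j) = 0" using \<open>?T = 0\<^sub>m d d\<close> by simp
    then show "T $$ (i, j) = (c \<cdot>\<^sub>m 1\<^sub>m d) $$ (i, j)" using ij T(1) by simp
  qed (use T(1) in auto)
  then show ?thesis ..
qed

section \<open>Orthogonality of characters\<close>

text \<open>
  The entries of \<open>\<Sum>g. \<rho>(g) E \<sigma>(g\<^sup>-\<^sup>1)\<close>, where \<open>E\<close> is the matrix unit with its \<open>1\<close> at position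
  \<open>(i, j)\<close>: averaging turns an arbitrary matrix into an intertwiner.
\<close>

definition schur_average ::
  "('a, 'm) monoid_scheme \<Rightarrow> nat \<Rightarrow> nat \<Rightarrow> ('a \<Rightarrow> complex mat) \<Rightarrow> ('a \<Rightarrow> complex mat) \<Rightarrow> nat \<Rightarrow> nat \<Rightarrow> complex mat"
  where "schur_average G d e \<rho> \<sigma> i j =
    mat d e (\<lambda>(k, l). \<Sum>g\<in>carrier G. \<rho> g $$ (k, i) * \<sigma> (inv\<^bsub>G\<^esub> g) $$ (j, l))"

lemma schur_average_carrier: "schur_average G d e \<rho> \<sigma> i j \<in> carrier_mat d e"
  by (simp add: schur_average_def)

lemma schur_average_intertwines:
  fixes G (structure)
  assumes G: "group G" and \<rho>: "representation G d \<rho>" and \<sigma>: "representation G e \<sigma>"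
    and ij: "i < d" "j < e"
  shows "intertwines G (schur_average G d e \<rho> \<sigma> i j) \<rho> \<sigma>"
  unfolding intertwines_def
proof
  interpret group G by fact
  let ?T = "schur_average G d e \<rho> \<sigma> i j"
  fix h assume h: "h \<in> carrier G"
  note R = representation_carrier[OF \<rho>] and S = representation_carrier[OF \<sigma>]
  have cancel: "inv h \<otimes> (h \<otimes> g) = g" "h \<otimes> (inv h \<otimes> g) = g" if "g \<in> carrier G" for g
    using h that by (simp_all flip: m_assoc)
  show "\<rho> h * ?T = ?T * \<sigma> h"
  proof (rule eq_matI)
    fix k l assume "k < dim_row (?T * \<sigma> h)" "l < dim_col (?T * \<sigma> h)"
    then have kl: "k < d" "l < e" using S[OF h] by (auto simp: schur_average_def)
    have "(\<rho> h * ?T) $$ (k, l)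
        = (\<Sum>m<d. \<rho> h $$ (k, m) * (\<Sum>g\<in>carrier G. \<rho> g $$ (m, i) * \<sigma> (inv g) $$ (j, l)))"
      using kl by (subst mult_mat_index_sum[OF R[OF h] schur_average_carrier]) (auto simp: schur_average_def)
    also have "\<dots> = (\<Sum>g\<in>carrier G. (\<Sum>m<d. \<rho> h $$ (k, m) * \<rho> g $$ (m, i)) * \<sigma> (inv g) $$ (j, l))"
      unfolding sum_distrib_left sum_distrib_right by (subst sum.swap) (simp add: mult.assoc)
    also have "\<dots> = (\<Sum>g\<in>carrier G. \<rho> (h \<otimes> g) $$ (k, i) * \<sigma> (inv g) $$ (j, l))"
      using kl ij by (intro sum.cong refl) (simp add: representation_mult[OF \<rho> h] mult_mat_index_sum[OF R[OF h] R])
    also have "\<dots> = (\<Sum>g\<in>carrier G. \<rho> g $$ (k, i) * \<sigma> (inv g \<otimes> h) $$ (j, l))"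
      by (rule sum.reindex_bij_witness[where i = "\<lambda>g. inv h \<otimes> g" and j = "\<lambda>g. h \<otimes> g"])
        (use h in \<open>auto simp: inv_mult_group m_assoc cancel\<close>)
    also have "\<dots> = (\<Sum>g\<in>carrier G. \<rho> g $$ (k, i) * (\<Sum>m<e. \<sigma> (inv g) $$ (j, m) * \<sigma> h $$ (m, l)))"
      using kl ij h by (intro sum.cong refl) (simp add: representation_mult[OF \<sigma>] mult_mat_index_sum[OF S S])
    also have "\<dots> = (\<Sum>m<e. (\<Sum>g\<in>carrier G. \<rho> g $$ (k, i) * \<sigma> (inv g) $$ (j, m)) * \<sigma> h $$ (m, l))"
      unfolding sum_distrib_left sum_distrib_right by (subst sum.swap) (simp add: mult.assoc)
    also have "\<dots> = (?T * \<sigma> h) $$ (k, l)"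
      using kl by (subst mult_mat_index_sum[OF schur_average_carrier S[OF h]]) (auto simp: schur_average_def)
    finally show "(\<rho> h * ?T) $$ (k, l) = (?T * \<sigma> h) $$ (k, l)" .
  qed (use R[OF h] S[OF h] in \<open>auto simp: schur_average_def\<close>)
qed

text \<open>
  The diagonal entries \<open>\<rho>(g)\<^sub>i\<^sub>i\<close> and \<open>\<sigma>(g\<^sup>-\<^sup>1)\<^sub>j\<^sub>j\<close> meet in the entry \<open>(i, j)\<close> of the average for \<open>(i, j)\<close>.
\<close>

lemma sum_trace_products:
  fixes G (structure)
  assumes G: "group G" and \<rho>: "representation G d \<rho>" and \<sigma>: "representation G e \<sigma>"
  shows "(\<Sum>g\<in>carrier G. trace_mat (\<rho> g) * trace_mat (\<sigma> (inv g)))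
    = (\<Sum>i<d. \<Sum>j<e. schur_average G d e \<rho> \<sigma> i j $$ (i, j))"
proof -
  interpret group G by fact
  have "(\<Sum>g\<in>carrier G. trace_mat (\<rho> g) * trace_mat (\<sigma> (inv g)))
    = (\<Sum>g\<in>carrier G. \<Sum>i<d. \<Sum>j<e. \<rho> g $$ (i, i) * \<sigma> (inv g) $$ (j, j))"
  proof (rule sum.cong[OF refl])
    fix g assume g: "g \<in> carrier G"
    have "dim_row (\<rho> g) = d" "dim_row (\<sigma> (inv g)) = e"
      using representation_carrier[OF \<rho> g] representation_carrier[OF \<sigma>, of "inv g"] g by auto
    then show "trace_mat (\<rho> g) * trace_mat (\<sigma> (inv g)) = (\<Sum>i<d. \<Sum>j<e. \<rho> g $$ (i, i) * \<sigma> (inv g) $$ (j, j))"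
      by (simp add: trace_mat_def sum_product)
  qed
  also have "\<dots> = (\<Sum>i<d. \<Sum>j<e. \<Sum>g\<in>carrier G. \<rho> g $$ (i, i) * \<sigma> (inv g) $$ (j, j))"
    by (subst sum.swap, rule sum.cong[OF refl], rule sum.swap)
  also have "\<dots> = (\<Sum>i<d. \<Sum>j<e. schur_average G d e \<rho> \<sigma> i j $$ (i, j))"
    by (simp add: schur_average_def)
  finally show ?thesis .
qed

text \<open>
  A nonzero average would be an intertwiner and force equal traces, so all the averages vanish.
\<close>

lemma orthogonality_distinct:
  fixes G (structure)
  assumes G: "group G" and \<rho>: "irreducible_representation G d \<rho>" and \<sigma>: "irreducible_representation G e \<sigma>"
    and ne: "character G \<rho> \<noteq> character G \<sigma>"
  shows "(\<Sum>g\<in>carrier G. trace_mat (\<rho> g) * trace_mat (\<sigma> (inv g))) = 0"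
proof -
  have rep: "representation G d \<rho>" "representation G e \<sigma>"
    using \<rho> \<sigma> unfolding irreducible_representation_def by blast+
  have "schur_average G d e \<rho> \<sigma> i j = 0\<^sub>m d e" if "i < d" "j < e" for i j
  proof (rule ccontr)
    assume "schur_average G d e \<rho> \<sigma> i j \<noteq> 0\<^sub>m d e"
    then have "trace_mat (\<rho> g) = trace_mat (\<sigma> g)" if "g \<in> carrier G" for g
      using trace_eq_if_intertwiner[OF \<rho> \<sigma> schur_average_carrier _ schur_average_intertwines[OF G rep] that]
        \<open>i < d\<close> \<open>j < e\<close> by blast
    then show False using ne unfolding character_def by (auto simp: restrict_def)
  qed
  then show ?thesis unfolding sum_trace_products[OF G rep] by simp
qed

text \<open>
  The average for \<open>(i, j)\<close> is a scalar \<open>c\<close> by Schur's lemma. Its trace \<open>d c\<close> is the sum over \<open>g\<close> of the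
  \<open>(j, i)\<close> entries of \<open>\<rho>(g\<^sup>-\<^sup>1) \<rho>(g) = 1\<close>, that is, \<open>n\<close> if \<open>i = j\<close> and \<open>0\<close> otherwise.
\<close>

lemma orthogonality_same:
  fixes G (structure)
  assumes G: "group G" and \<rho>: "irreducible_representation G d \<rho>"
  shows "(\<Sum>g\<in>carrier G. trace_mat (\<rho> g) * trace_mat (\<rho> (inv g))) = of_nat (Coset.order G)"
proof -
  interpret group G by fact
  have d: "d > 0" and rep: "representation G d \<rho>"
    using \<rho> unfolding irreducible_representation_def by auto
  note R = representation_carrier[OF rep]
  let ?T = "schur_average G d d \<rho> \<rho>"
  have T: "of_nat d * ?T i j $$ (i, j) = (if i = j then of_nat (Coset.order G) else 0)"
    if ij: "i < d" "j < d" for i j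
  proof -
    obtain c where c: "?T i j = c \<cdot>\<^sub>m 1\<^sub>m d"
      using intertwiner_scalar[OF \<rho> schur_average_carrier schur_average_intertwines[OF G rep rep ij]] by blast
    have "of_nat d * c = (\<Sum>k<d. ?T i j $$ (k, k))" unfolding c by simp
    also have "\<dots> = (\<Sum>k<d. \<Sum>g\<in>carrier G. \<rho> g $$ (k, i) * \<rho> (inv g) $$ (j, k))"
      by (simp add: schur_average_def)
    also have "\<dots> = (\<Sum>g\<in>carrier G. \<Sum>k<d. \<rho> (inv g) $$ (j, k) * \<rho> g $$ (k, i))"
      by (subst sum.swap) (simp add: mult.commute)
    also have "\<dots> = (\<Sum>g\<in>carrier G. (\<rho> (inv g) * \<rho> g) $$ (j, i))"
      using ij by (intro sum.cong refl) (simp add: mult_mat_index_sum[OF R R])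
    also have "\<dots> = (\<Sum>g\<in>carrier G. 1\<^sub>m d $$ (j, i))"
      by (intro sum.cong refl) (simp add: representation_mult[OF rep, symmetric] representation_one[OF G rep])
    also have "\<dots> = (if i = j then of_nat (Coset.order G) else 0)"
      using ij by (simp add: Coset.order_def)
    finally show ?thesis unfolding c using ij by auto
  qed
  have "of_nat d * (\<Sum>i<d. \<Sum>j<d. ?T i j $$ (i, j)) = (\<Sum>i<d. \<Sum>j<d. if i = j then of_nat (Coset.order G) else 0)"
    unfolding sum_distrib_left by (intro sum.cong refl) (simp add: T)
  also have "\<dots> = of_nat d * of_nat (Coset.order G)" by simp
  finally show ?thesis unfolding sum_trace_products[OF G rep rep] using d by simp
qed

lemma Irr_orthogonal:
  fixes G (structure)
  assumes G: "group G" and \<chi>: "\<chi> \<in> Irr G" and \<psi>: "\<psi> \<in> Irr G"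
  shows "(\<Sum>g\<in>carrier G. \<chi> g * \<psi> (inv g)) = (if \<chi> = \<psi> then of_nat (Coset.order G) else 0)"
proof -
  interpret group G by fact
  obtain d \<rho> where \<rho>: "\<chi> = character G \<rho>" "irreducible_representation G d \<rho>"
    using \<chi> unfolding Irr_def by blast
  obtain e \<sigma> where \<sigma>: "\<psi> = character G \<sigma>" "irreducible_representation G e \<sigma>"
    using \<psi> unfolding Irr_def by blast
  show ?thesis
  proof (cases "\<chi> = \<psi>")
    case True
    then have "(\<Sum>g\<in>carrier G. \<chi> g * \<psi> (inv g)) = (\<Sum>g\<in>carrier G. trace_mat (\<rho> g) * trace_mat (\<rho> (inv g)))"
      using \<rho>(1) by (auto simp: character_def intro!: sum.cong)
    then show ?thesis using True orthogonality_same[OF G \<rho>(2)] by simp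
  next
    case False
    have "(\<Sum>g\<in>carrier G. \<chi> g * \<psi> (inv g)) = (\<Sum>g\<in>carrier G. trace_mat (\<rho> g) * trace_mat (\<sigma> (inv g)))"
      using \<rho>(1) \<sigma>(1) by (auto simp: character_def intro!: sum.cong)
    then show ?thesis using False orthogonality_distinct[OF G \<rho>(2) \<sigma>(2)] \<rho>(1) \<sigma>(1) by simp
  qed
qed

lemma Irr_conj_invariant:
  fixes G (structure)
  assumes G: "group G" and \<chi>: "\<chi> \<in> Irr G" and x: "x \<in> carrier G" "y \<in> conj_class G x"
  shows "\<chi> y = \<chi> x"
proof -
  interpret group G by fact
  obtain d \<rho> where \<rho>: "\<chi> = character G \<rho>" "irreducible_representation G d \<rho>"
    using \<chi> unfolding Irr_def by blast
  have rep: "representation G d \<rho>" using \<rho>(2) unfolding irreducible_representation_def by blast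
  note R = representation_carrier[OF rep] and M = representation_mult[OF rep, symmetric]
  obtain g where g: "g \<in> carrier G" "y = g \<otimes> x \<otimes> inv g" using x(2) unfolding conj_class_def by blast
  have "trace_mat (\<rho> y) = trace_mat (\<rho> (g \<otimes> x) * \<rho> (inv g))" using g x(1) by (simp add: M)
  also have "\<dots> = trace_mat (\<rho> (inv g) * \<rho> (g \<otimes> x))"
    using g x(1) by (intro trace_mat_commute[of _ d d] R) auto
  also have "\<rho> (inv g) * \<rho> (g \<otimes> x) = \<rho> x" using g x(1) by (simp add: M m_assoc[symmetric])
  finally show ?thesis using g x(1) by (simp add: \<rho>(1) character_def)
qed

lemma sum_fun_apply: "(\<Sum>v\<in>A. f v) x = (\<Sum>v\<in>A. f v x)"
  for f :: "'b \<Rightarrow> 'a \<Rightarrow> complex"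
  by (induction A rule: infinite_finite_induct) auto

text \<open>
  The irreducible characters lie in the span of the indicator functions of the classes, and orthogonality
  makes them linearly independent.
\<close>

lemma card_Irr_le_card_conj_classes:
  fixes G :: "('a, 'm) monoid_scheme" (structure)
  assumes G: "group G" and fin: "finite (carrier G)"
  shows "finite (Irr G) \<and> card (Irr G) \<le> card (conj_classes G)"
proof -
  interpret group G by fact
  interpret V: vector_space "\<lambda>(c::complex) (f::'a \<Rightarrow> complex) x. c * f x"
    by unfold_locales (auto simp: fun_eq_iff algebra_simps)
  \<comment> \<open>Characters are undefined outside the group; extending them by \<open>0\<close> instead places them in the span.\<close>
  define ext where "ext \<chi> = (\<lambda>x. if x \<in> carrier G then \<chi> x else 0)" for \<chi> :: "'a \<Rightarrow> complex"
  define ind where "ind C = (\<lambda>x. if x \<in> C then 1 else 0 :: complex)" for C :: "'a set"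
  have inj: "inj_on ext (Irr G)"
  proof (rule inj_onI)
    fix \<chi> \<psi> assume "\<chi> \<in> Irr G" "\<psi> \<in> Irr G" and eq: "ext \<chi> = ext \<psi>"
    then obtain \<rho> \<sigma> where "\<chi> = character G \<rho>" "\<psi> = character G \<sigma>" unfolding Irr_def by blast
    then have "\<chi> \<in> extensional (carrier G)" "\<psi> \<in> extensional (carrier G)" by (auto simp: character_def)
    moreover have "\<chi> x = \<psi> x" if "x \<in> carrier G" for x using fun_cong[OF eq, of x] that by (simp add: ext_def)
    ultimately show "\<chi> = \<psi>" by (rule extensionalityI)
  qed
  have finC: "finite (conj_classes G)" using fin unfolding conj_classes_def by simp
  have "ext ` Irr G \<subseteq> V.span (ind ` conj_classes G)"
  proof clarify
    fix \<chi> assume \<chi>: "\<chi> \<in> Irr G"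
    have "ext \<chi> = (\<Sum>C\<in>conj_classes G. (\<lambda>x. \<chi> (SOME c. c \<in> C) * ind C x))"
    proof
      fix x
      show "ext \<chi> x = (\<Sum>C\<in>conj_classes G. (\<lambda>x. \<chi> (SOME c. c \<in> C) * ind C x)) x"
      proof (cases "x \<in> carrier G")
        case False
        then have "x \<notin> C" if "C \<in> conj_classes G" for C
          using that conj_class_subset unfolding conj_classes_def by blast
        then show ?thesis using False by (simp add: sum_fun_apply ext_def ind_def)
      next
        case True
        let ?C = "conj_class G x"
        have C: "?C \<in> conj_classes G" using True unfolding conj_classes_def by blast
        have "x \<notin> D" if "D \<in> conj_classes G" "D \<noteq> ?C" for D
          using disjoint_conj_classes[OF that(1) C that(2)] conj_class_refl[OF True] by blast
        then have "(\<Sum>D\<in>conj_classes G. \<chi> (SOME c. c \<in> D) * ind D x)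
            = (\<Sum>D\<in>conj_classes G. if D = ?C then \<chi> (SOME c. c \<in> D) else 0)"
          using conj_class_refl[OF True] by (intro sum.cong refl) (auto simp: ind_def)
        also have "\<dots> = \<chi> (SOME c. c \<in> ?C)" using finC C by (simp add: sum.delta)
        also have "\<dots> = \<chi> x"
          using Irr_conj_invariant[OF G \<chi> True] someI[of "\<lambda>c. c \<in> ?C", OF conj_class_refl[OF True]] by blast
        finally show ?thesis using True by (simp add: sum_fun_apply ext_def)
      qed
    qed
    also have "\<dots> \<in> V.span (ind ` conj_classes G)"
      by (intro V.span_sum V.span_scale V.span_base) auto
    finally show "ext \<chi> \<in> V.span (ind ` conj_classes G)" .
  qed
  moreover have "V.independent (ext ` Irr G)"
    unfolding V.independent_explicit_module
  proof (intro allI impI)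
    fix t u v assume t: "finite t" "t \<subseteq> ext ` Irr G" and v: "v \<in> t"
      and zero: "(\<Sum>w\<in>t. (\<lambda>x. u w * w x)) = (0 :: 'a \<Rightarrow> complex)"
    obtain \<psi> where \<psi>: "\<psi> \<in> Irr G" "v = ext \<psi>" using t(2) v by blast
    have orth: "(\<Sum>g\<in>carrier G. w g * \<psi> (inv g)) = (if w = v then of_nat (Coset.order G) else 0)" if w: "w \<in> t" for w
    proof -
      obtain \<chi> where \<chi>: "\<chi> \<in> Irr G" "w = ext \<chi>" using t(2) w by blast
      have "w = v \<longleftrightarrow> \<chi> = \<psi>" using inj \<chi> \<psi> by (auto simp: inj_on_eq_iff)
      moreover have "(\<Sum>g\<in>carrier G. w g * \<psi> (inv g)) = (\<Sum>g\<in>carrier G. \<chi> g * \<psi> (inv g))"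
        by (intro sum.cong refl) (simp add: \<chi>(2) ext_def)
      ultimately show ?thesis using Irr_orthogonal[OF G \<chi>(1) \<psi>(1)] by simp
    qed
    have "0 = (\<Sum>g\<in>carrier G. (\<Sum>w\<in>t. u w * w g) * \<psi> (inv g))"
      using fun_cong[OF zero] by (simp add: sum_fun_apply)
    also have "\<dots> = (\<Sum>w\<in>t. u w * (\<Sum>g\<in>carrier G. w g * \<psi> (inv g)))"
      unfolding sum_distrib_left sum_distrib_right by (subst sum.swap) (simp add: mult.assoc)
    also have "\<dots> = (\<Sum>w\<in>t. if w = v then u w * of_nat (Coset.order G) else 0)"
      by (intro sum.cong refl) (simp add: orth)
    also have "\<dots> = u v * of_nat (Coset.order G)" using t(1) v by (simp add: sum.delta)
    finally show "u v = 0" using fin by (simp add: order_gt_0_iff_finite[THEN iffD2, THEN gr_implies_not0])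
  qed
  ultimately have "finite (ext ` Irr G) \<and> card (ext ` Irr G) \<le> card (ind ` conj_classes G)"
    using finC by (intro V.independent_span_bound) auto
  then show ?thesis
    using inj card_image_le[OF finC, of ind] by (auto simp: card_image dest: finite_imageD)
qed

lemma codegree_bounds:
  assumes G: "group G" and fin: "finite (carrier G)" and \<chi>: "\<chi> \<in> Irr G"
  shows "0 \<le> codegree G \<chi>" "codegree G \<chi> \<le> real (Coset.order G)"
proof -
  obtain d :: nat where d: "d > 0" "\<chi> \<one>\<^bsub>G\<^esub> = of_nat d" using Irr_at_one[OF G \<chi>] by blast
  show "0 \<le> codegree G \<chi>" unfolding codegree_def by (simp add: d)
  have "rcosets\<^bsub>G\<^esub> (char_kernel G \<chi>) = (\<lambda>a. char_kernel G \<chi> #>\<^bsub>G\<^esub> a) ` carrier G"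
    unfolding RCOSETS_def by blast
  then have "card (rcosets\<^bsub>G\<^esub> (char_kernel G \<chi>)) \<le> Coset.order G"
    using card_image_le[OF fin] by (simp add: Coset.order_def)
  then have "real (card (rcosets\<^bsub>G\<^esub> (char_kernel G \<chi>))) / real d \<le> real (Coset.order G) / 1"
    using d by (intro frac_le) auto
  then show "codegree G \<chi> \<le> real (Coset.order G)" unfolding codegree_def by (simp add: d)
qed

lemma sum_codegrees_le:
  assumes G: "group G" and fin: "finite (carrier G)"
  shows "sum_codegrees G \<le> real (card (conj_classes G)) * real (Coset.order G)"
proof -
  have "sum_codegrees G \<le> real (card (Irr G)) * real (Coset.order G)"
    unfolding sum_codegrees_def using codegree_bounds(2)[OF G fin] by (intro sum_bounded_above)
  also have "\<dots> \<le> real (card (conj_classes G)) * real (Coset.order G)"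
    using card_Irr_le_card_conj_classes[OF G fin] by (intro mult_right_mono) auto
  finally show ?thesis .
qed

section \<open>Codegrees of cyclic groups\<close>

text \<open>
  The additive character \<open>a \<mapsto> exp (2 \<pi> i a / n)\<close>.
\<close>

definition cyclic_char :: "nat \<Rightarrow> int \<Rightarrow> complex"
  where "cyclic_char n a = cis (2 * pi * (of_int a / of_nat n))"

lemma cyclic_char_add: "cyclic_char n (a + b) = cyclic_char n a * cyclic_char n b"
  by (simp add: cyclic_char_def cis_mult add_divide_distrib distrib_left)

lemma cyclic_char_eq_1_iff:
  assumes "n > 0"
  shows "cyclic_char n a = 1 \<longleftrightarrow> int n dvd a"
proof
  assume "int n dvd a"
  then obtain b where "a = int n * b" by (rule dvdE)
  then have "cyclic_char n a = cis (2 * pi * of_int b)" using assms by (simp add: cyclic_char_def)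
  then show "cyclic_char n a = 1" by (simp add: cis_multiple_2pi)
next
  assume "cyclic_char n a = 1"
  then have "cos (2 * pi * (of_int a / of_nat n)) = 1"
    unfolding cyclic_char_def by (metis cis.simps(1) one_complex.simps(1))
  then obtain b :: int where "2 * pi * (of_int a / of_nat n) = of_int b * (2 * pi)"
    unfolding cos_one_2pi_int by auto
  then have "real_of_int a = of_int (int n * b)" using assms by (simp add: field_simps)
  then have "a = int n * b" by (simp only: of_int_eq_iff)
  then show "int n dvd a" by simp
qed

lemma cyclic_char_nonzero: "cyclic_char n a \<noteq> 0" by (simp add: cyclic_char_def)

lemma cyclic_char_cong:
  assumes "n > 0" "int n dvd a - b"
  shows "cyclic_char n a = cyclic_char n b"
  using cyclic_char_add[of n "a - b" b] cyclic_char_eq_1_iff[OF assms(1), of "a - b"] assms(2) by simp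

definition cyclic_rep :: "nat \<Rightarrow> nat \<Rightarrow> int \<Rightarrow> complex mat"
  where "cyclic_rep n j k = mat 1 1 (\<lambda>_. cyclic_char n (int j * k))"

lemma representation_one_dim_irreducible:
  assumes "representation G 1 \<rho>"
  shows "irreducible_representation G 1 \<rho>"
  unfolding irreducible_representation_def
proof (intro conjI allI impI)
  fix W assume "VectorSpace.subspace class_ring W (module_vec TYPE(complex) 1) \<and>
    (\<forall>g\<in>carrier G. \<forall>v\<in>W. \<rho> g *\<^sub>v v \<in> W)"
  then have "submodule class_ring W (module_vec TYPE(complex) 1)"
    unfolding VectorSpace.subspace_def by blast
  then have sub: "W \<subseteq> carrier_vec 1" "0\<^sub>v 1 \<in> W" "\<And>c v. v \<in> W \<Longrightarrow> c \<cdot>\<^sub>v v \<in> W"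
    unfolding submodule_def by (auto simp: module_vec_simps class_ring_simps)
  show "W = {0\<^sub>v 1} \<or> W = carrier_vec 1"
  proof (cases "W = {0\<^sub>v 1}")
    case False
    then obtain v where v: "v \<in> W" "v \<noteq> 0\<^sub>v 1" using sub(2) by blast
    then have v1: "dim_vec v = 1" using sub(1) by auto
    have "v $ 0 \<noteq> 0"
    proof
      assume "v $ 0 = 0"
      then have "v = 0\<^sub>v 1" using v1 by (intro eq_vecI) auto
      then show False using v(2) by simp
    qed
    then have "w = (w $ 0 / v $ 0) \<cdot>\<^sub>v v" if "w \<in> carrier_vec 1" for w
      using that v1 by (intro eq_vecI) auto
    then have "carrier_vec 1 \<subseteq> W" using sub(3)[OF v(1)] by (metis subsetI)
    then show ?thesis using sub(1) by blast
  qed simp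
qed (use assms in auto)

lemma cyclic_rep_representation:
  assumes n: "n > 0"
  shows "representation (integer_mod_group n) 1 (cyclic_rep n j)"
proof -
  have hom: "cyclic_rep n j ((x + y) mod int n) = cyclic_rep n j x * cyclic_rep n j y" for x y
  proof -
    have "int n dvd int j * ((x + y) mod int n) - int j * (x + y)"
      by (metis dvd_mult mod_0_imp_dvd mod_mod_trivial mod_diff_left_eq cancel_comm_monoid_add_class.diff_cancel mod_0 right_diff_distrib)
    then have "cyclic_char n (int j * ((x + y) mod int n)) = cyclic_char n (int j * x) * cyclic_char n (int j * y)"
      using cyclic_char_cong[OF n] cyclic_char_add[of n "int j * x" "int j * y"] by (simp add: distrib_left)
    then show ?thesis by (intro eq_matI) (auto simp: cyclic_rep_def scalar_prod_def)
  qed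
  have unit: "cyclic_rep n j x \<in> Units (ring_mat TYPE(complex) 1 ())" for x
  proof -
    have "cyclic_rep n j x * cyclic_rep n j (- x) = 1\<^sub>m 1" "cyclic_rep n j (- x) * cyclic_rep n j x = 1\<^sub>m 1"
      using cyclic_char_add[of n "int j * x" "int j * - x"] cyclic_char_eq_1_iff[OF n, of 0]
      by (auto intro!: eq_matI simp: cyclic_rep_def scalar_prod_def mult.commute)
    moreover have "cyclic_rep n j y \<in> carrier_mat 1 1" for y by (simp add: cyclic_rep_def)
    ultimately show ?thesis unfolding Units_def ring_mat_simps by blast
  qed
  show ?thesis
    unfolding representation_def hom_def using hom unit by (auto simp: units_of_def ring_mat_simps)
qed

lemma cyclic_character:
  assumes "k \<in> carrier (integer_mod_group n)"
  shows "character (integer_mod_group n) (cyclic_rep n j) k = cyclic_char n (int j * k)"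
  using assms by (simp add: character_def cyclic_rep_def trace_mat_def)

lemma cyclic_character_in_Irr:
  assumes "n > 0"
  shows "character (integer_mod_group n) (cyclic_rep n j) \<in> Irr (integer_mod_group n)"
  unfolding Irr_def using representation_one_dim_irreducible[OF cyclic_rep_representation[OF assms]] by blast

lemma cyclic_characters_distinct:
  assumes n: "n > 1"
  shows "inj_on (\<lambda>j. character (integer_mod_group n) (cyclic_rep n j)) {..<n}"
proof (rule inj_onI)
  fix i j assume ij: "i \<in> {..<n}" "j \<in> {..<n}"
    and eq: "character (integer_mod_group n) (cyclic_rep n i) = character (integer_mod_group n) (cyclic_rep n j)"
  \<comment> \<open>Already the values at the generator \<open>1\<close> differ.\<close>
  have "1 \<in> carrier (integer_mod_group n)" using n by simp
  then have "cyclic_char n (int i) = cyclic_char n (int j)"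
    using fun_cong[OF eq, of 1] by (simp add: cyclic_character)
  then have "cyclic_char n (int i - int j) = 1"
    using cyclic_char_add[of n "int i - int j" "int j"] cyclic_char_nonzero[of n "int j"] by simp
  then have "int n dvd int i - int j" using cyclic_char_eq_1_iff n by simp
  then have "int i mod int n = int j mod int n" by (simp add: mod_eq_dvd_iff)
  then show "i = j" using ij by simp
qed

text \<open>
  With \<open>g = gcd(j, n)\<close> and \<open>m = n / g\<close>, an element \<open>k\<close> is in the kernel iff \<open>n\<close> divides \<open>j k\<close>, that is, iff
  \<open>m\<close> divides \<open>k\<close>. So the kernel has \<open>g\<close> elements and index \<open>m\<close>. The case \<open>j = 0\<close> fits in, with \<open>g = n\<close>.
\<close>

lemma codegree_cyclic_character:
  assumes n: "n > 1"
  shows "codegree (integer_mod_group n) (character (integer_mod_group n) (cyclic_rep n j)) = real (n div gcd j n)"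
proof -
  let ?C = "integer_mod_group n"
  let ?\<chi> = "character ?C (cyclic_rep n j)"
  interpret C: group ?C by simp
  define g m where "g = gcd j n" and "m = n div gcd j n"
  have g: "g > 0" "n = g * m" using n by (auto simp: g_def m_def)
  have m: "m > 0" using g n by (auto intro: Nat.gr0I)
  have carrier: "carrier ?C = {0..<int n}" using n by (simp add: carrier_integer_mod_group)
  have dvd_iff: "int n dvd int j * k \<longleftrightarrow> int m dvd k" for k
  proof -
    obtain j' where j': "j = g * j'" using g_def by (metis dvdE gcd_dvd1)
    have "coprime m j'"
    proof -
      have "j div g = j'" using j' g(1) by simp
      then show ?thesis
        using div_gcd_coprime[of j n] n unfolding g_def m_def by (simp add: coprime_commute)
    qed
    have "int n dvd int j * k \<longleftrightarrow> int m dvd int j' * k"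
      using g by (simp add: j' mult.assoc)
    also have "\<dots> \<longleftrightarrow> int m dvd k"
      using \<open>coprime m j'\<close> by (simp add: coprime_dvd_mult_right_iff)
    finally show ?thesis .
  qed
  have "cyclic_char n 0 = 1" using cyclic_char_eq_1_iff[of n 0] n by simp
  then have one: "?\<chi> 0 = 1" by (simp add: cyclic_character)
  have ker: "char_kernel ?C ?\<chi> = {k \<in> {0..<int n}. int m dvd k}"
  proof (rule Set.set_eqI)
    fix k
    have "?\<chi> k = 1 \<longleftrightarrow> int m dvd k" if "k \<in> {0..<int n}"
    proof -
      have "?\<chi> k = cyclic_char n (int j * k)" using that carrier by (intro cyclic_character) simp
      then show ?thesis using cyclic_char_eq_1_iff[of n "int j * k"] n dvd_iff[of k] by simp
    qed
    then show "k \<in> char_kernel ?C ?\<chi> \<longleftrightarrow> k \<in> {k \<in> {0..<int n}. int m dvd k}"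
      unfolding char_kernel_def carrier using one by auto
  qed
  have mn: "int m dvd int n" using g by simp
  have "subgroup (char_kernel ?C ?\<chi>) ?C"
  proof (rule C.subgroupI)
    have "0 \<in> char_kernel ?C ?\<chi>" using n unfolding ker by simp
    then show "char_kernel ?C ?\<chi> \<noteq> {}" by blast
    fix a b assume ab: "a \<in> char_kernel ?C ?\<chi>" "b \<in> char_kernel ?C ?\<chi>"
    then show "a \<otimes>\<^bsub>?C\<^esub> b \<in> char_kernel ?C ?\<chi>"
      using n mn unfolding ker by (auto simp: dvd_mod)
    show "inv\<^bsub>?C\<^esub> a \<in> char_kernel ?C ?\<chi>"
      using ab n mn unfolding ker by (auto simp: carrier dvd_mod)
  qed (auto simp: char_kernel_def)
  then have "card (rcosets\<^bsub>?C\<^esub> (char_kernel ?C ?\<chi>)) * card (char_kernel ?C ?\<chi>) = n"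
    using C.lagrange by (simp add: Coset.order_def carrier)
  moreover have "card (char_kernel ?C ?\<chi>) = g"
  proof -
    have "bij_betw (\<lambda>i. int (m * i)) {..<g} (char_kernel ?C ?\<chi>)"
    proof (rule bij_betwI')
      fix x y assume "x \<in> {..<g}" "y \<in> {..<g}"
      show "(int (m * x) = int (m * y)) = (x = y)" using m by simp
      show "int (m * x) \<in> char_kernel ?C ?\<chi>"
        using \<open>x \<in> {..<g}\<close> m unfolding ker by (auto simp: g(2) mult.commute simp flip: of_nat_mult)
    next
      fix k assume k: "k \<in> char_kernel ?C ?\<chi>"
      then obtain l where l: "k = int m * l" unfolding ker by blast
      have "0 \<le> int m * l" "int m * l < int m * int g" using k l unfolding ker by (auto simp: g(2) mult.commute)
      then have "0 \<le> l" "l < int g" using m by (auto simp: zero_le_mult_iff)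
      then show "\<exists>x\<in>{..<g}. k = int (m * x)" using l by (intro bexI[of _ "nat l"]) auto
    qed
    then show ?thesis by (simp add: bij_betw_same_card[symmetric])
  qed
  ultimately have "card (rcosets\<^bsub>?C\<^esub> (char_kernel ?C ?\<chi>)) = m" using g by (simp add: mult.commute)
  then show ?thesis unfolding codegree_def using one by (simp add: m_def)
qed

lemma sum_codegrees_cyclic_ge:
  assumes n: "n > 1"
  shows "real (divisor_totient_sum n) \<le> sum_codegrees (integer_mod_group n)"
proof -
  let ?C = "integer_mod_group n"
  let ?\<chi> = "\<lambda>j. character ?C (cyclic_rep n j)"
  have fin: "finite (carrier ?C)" using n by (simp add: carrier_integer_mod_group)
  have "real (divisor_totient_sum n) = (\<Sum>j<n. codegree ?C (?\<chi> j))"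
    using n by (simp add: sum_gcd_quotient_eq_divisor_totient_sum[symmetric] codegree_cyclic_character)
  also have "\<dots> = (\<Sum>\<chi>\<in>?\<chi> ` {..<n}. codegree ?C \<chi>)"
    using cyclic_characters_distinct[OF n] by (simp add: sum.reindex)
  also have "\<dots> \<le> sum_codegrees ?C"
    unfolding sum_codegrees_def
  proof (rule sum_mono2)
    show "finite (Irr ?C)" using card_Irr_le_card_conj_classes[OF _ fin] by simp
    show "?\<chi> ` {..<n} \<subseteq> Irr ?C" using cyclic_character_in_Irr n by auto
    show "0 \<le> codegree ?C \<chi>" if "\<chi> \<in> Irr ?C - ?\<chi> ` {..<n}" for \<chi>
      using codegree_bounds(1)[OF _ fin] that by simp
  qed
  finally show ?thesis .
qed

section \<open>Comparison of the two sums\<close>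

theorem theorem1p3:
  fixes G :: "('a, 'm) monoid_scheme" and n p :: nat and P :: "'a set"
  assumes "group G"
    and "finite (carrier G)"
    and "n = Coset.order G"
    and "n > 1"
    and "p = Max (prime_factors n)"
    and "sylow_subgroup p P G"
    and "\<not> P \<lhd> G \<or> \<not> comm_group (G\<lparr>carrier := P\<rparr>)"
  shows "sum_codegrees G \<le> sum_codegrees (integer_mod_group n)"
proof -
  let ?k = "card (conj_classes G)"
  have p: "prime p" using assms(6) unfolding sylow_subgroup_def by blast
  have "(p + 1) * ?k \<le> 2 * n"
    using card_conj_classes_le[OF assms(1,2,6,7)] assms(3) by simp
  then have "(p + 1) * (?k * n) \<le> 2 * n ^ 2"
    by (metis mult.assoc mult_le_mono1 power2_eq_square)
  also have "\<dots> \<le> (p + 1) * divisor_totient_sum n"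
  proof (rule divisor_totient_sum_lower_bound)
    show "q \<le> p" if "prime q" "q dvd n" for q
      unfolding assms(5) using that assms(4) by (intro Max_ge) (auto simp: prime_factors_dvd)
  qed (use assms(4) p prime_gt_0_nat in auto)
  finally have "?k * n \<le> divisor_totient_sum n" by (rule mult_left_le_imp_le) simp
  then have "real ?k * real n \<le> real (divisor_totient_sum n)"
    by (metis of_nat_le_iff of_nat_mult)
  moreover have "sum_codegrees G \<le> real ?k * real n"
    using sum_codegrees_le[OF assms(1,2)] assms(3) by simp
  ultimately show ?thesis using sum_codegrees_cyclic_ge[OF assms(4)] by linarith
qed

end
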